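(* Let $\Omega$ be a strictly pseudo-convex domain in $\mathbb{C}^n$ equipped with its minimal good family of polydiscs, let $k\ge1$ be an integer and $p\ge1$. Then $\Omega$ has the $(p,k)$-Bergman-Carleson embedding property: for every positive Borel measure $\mu$ on $\Omega$ such that there is $C_0>0$ with $$\mu(\Omega\cap P_a(2))\le C_0\,m_{k-1}(\Omega\cap P_a(2))\quad\text{for all }a\in\Omega,$$ there is $C>0$ such that $$\int_\Omega|f|^p\,d\mu\le C\|f\|^p_{A^p_{k-1}(\Omega)}\quad\text{for all }f\in A^p_{k-1}(\Omega).$$
   Context: $\Omega=\{r<0\}$ is a bounded connected open set of $\mathbb{C}^n$ with real valued $r\in\mathcal{C}^\infty(\mathbb{C}^n)$, $\mathrm{grad}\, r\neq0$ on $\partial\Omega$, $-r(z)\simeq\delta(z):=d(z,\Omega^c)$ on $\bar\Omega$. $dm_0=dm$ is Lebesgue measure, $dm_j=(j+1)v_{j+1}(-r)^j\,dm$ for $j\ge1$ ($v_j$ the volume of the unit ball of $\mathbb{C}^j$); $A^p_{k-1}(\Omega)$ is the space of holomorphic $f$ with $\|f\|^p_{A^p_{k-1}(\Omega)}=\int_\Omega|f|^p\,dm_{k-1}<\infty$. Minimal good family of polydiscs: let $\mathcal{U}$ be a neighbourhood of $\partial\Omega$ in $\Omega$ on which the normal projection $\pi$ onto $\partial\Omega$ is smooth and well defined. For each $\alpha\in\partial\Omega$ fix an orthonormal basis $(L_1,\dots,L_n)$ of $\mathbb{C}^n$ with $(L_2,\dots,L_n)$ a basis of the complex tangent space of $\partial\Omega$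 at $\alpha$. For $a\in\mathcal{U}$ and $t>0$, using the basis at $\pi(a)$, $P_a(t)=\{a+\sum_j\lambda_jL_j:\ |\lambda_1|<t|r(a)|,\ |\lambda_j|<t|r(a)|^{1/2}\ (j\ge2)\}$. For $a\in\Omega\setminus\mathcal{U}$, $P_a(t)$ is the polydisc centered at $a$ with sides parallel to the coordinate axes, of radius $t\delta(a)$ in the $z_1$ direction and $t\delta(a)^{1/2}$ in the other directions. (The normalization of $r$ is such that, for $a\in\mathcal{U}$, $P_a(2)$ is not contained in $\Omega$.) *)

theory Defs
  imports "HOL-Analysis.Analysis"
begin

text \<open>
  \<open>\<complex>\<^sup>n\<close> is the type \<open>complex^'n\<close>, with its Euclidean norm and with complex scalar
  multiplication \<open>*s\<close>; an index \<open>\<iota>\<close> of \<open>'n\<close>, arbitrary but fixed, plays the role of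
  the first coordinate.
\<close>

subsection \<open>Smooth and holomorphic functions\<close>

text \<open>Only used for open sets \<open>S\<close>; the derivatives are the real ones.\<close>

primrec Ck_on ::
  "nat \<Rightarrow> 'a::real_normed_vector set \<Rightarrow> ('a \<Rightarrow> 'b::real_normed_vector) \<Rightarrow> bool"
where
  "Ck_on 0 S f \<longleftrightarrow> continuous_on S f"
| "Ck_on (Suc k) S f \<longleftrightarrow>
     (\<forall>x\<in>S. f differentiable (at x)) \<and>
     (\<forall>v. Ck_on k S (\<lambda>x. frechet_derivative f (at x) v))"

definition smooth_on ::
  "'a::real_normed_vector set \<Rightarrow> ('a \<Rightarrow> 'b::real_normed_vector) \<Rightarrow> bool"
where
  "smooth_on S f \<longleftrightarrow> (\<forall>k. Ck_on k S f)"

definition holomorphic_several_on ::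
  "(complex^'n::finite \<Rightarrow> complex) \<Rightarrow> (complex^'n) set \<Rightarrow> bool"
where
  "holomorphic_several_on f S \<longleftrightarrow>
     (\<forall>z\<in>S. \<exists>D. (f has_derivative D) (at z) \<and> (\<forall>c v. D (c *s v) = c * D v))"

subsection \<open>Strictly pseudo-convex domains\<close>

definition smooth_bounded_domain ::
  "(complex^'n::finite) set \<Rightarrow> (complex^'n \<Rightarrow> real) \<Rightarrow> bool"
where
  "smooth_bounded_domain \<Omega> r \<longleftrightarrow>
     open \<Omega> \<and> connected \<Omega> \<and> bounded \<Omega> \<and> \<Omega> = {z. r z < 0} \<and>
     smooth_on UNIV r \<and>
     (\<forall>z\<in>frontier \<Omega>. \<not> (GDERIV r z :> 0)) \<and>
     (\<exists>c>0. \<exists>C>0. \<forall>z\<in>closure \<Omega>.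
        c * infdist z (- \<Omega>) \<le> - r z \<and> - r z \<le> C * infdist z (- \<Omega>))"

text \<open>The largest complex subspace \<open>T \<inter> \<i>T\<close> of the real tangent space \<open>T = ker dr\<close>.\<close>

definition complex_tangent_space ::
  "(complex^'n::finite \<Rightarrow> real) \<Rightarrow> complex^'n \<Rightarrow> (complex^'n) set"
where
  "complex_tangent_space r \<alpha> =
     {v. frechet_derivative r (at \<alpha>) v = 0 \<and> frechet_derivative r (at \<alpha>) (\<i> *s v) = 0}"

text \<open>The Wirtinger operators with respect to \<open>z\<^sub>j\<close> and to its conjugate.\<close>

definition wirtinger ::
  "'n::finite \<Rightarrow> (complex^'n \<Rightarrow> complex) \<Rightarrow> complex^'n \<Rightarrow> complex"
where
  "wirtinger j g z =
     (frechet_derivative g (at z) (axis j 1) - \<i> * frechet_derivative g (at z) (axis j \<i>)) / 2"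

definition wirtinger_bar ::
  "'n::finite \<Rightarrow> (complex^'n \<Rightarrow> complex) \<Rightarrow> complex^'n \<Rightarrow> complex"
where
  "wirtinger_bar j g z =
     (frechet_derivative g (at z) (axis j 1) + \<i> * frechet_derivative g (at z) (axis j \<i>)) / 2"

definition levi_form ::
  "(complex^'n::finite \<Rightarrow> real) \<Rightarrow> complex^'n \<Rightarrow> complex^'n \<Rightarrow> complex"
where
  "levi_form r \<alpha> w =
     (\<Sum>j\<in>UNIV. \<Sum>k\<in>UNIV.
        wirtinger j (wirtinger_bar k (\<lambda>z. complex_of_real (r z))) \<alpha> * (w $ j) * cnj (w $ k))"

text \<open>The Levi form is Hermitian, so its values are real.\<close>

definition strictly_pseudoconvex ::
  "(complex^'n::finite) set \<Rightarrow> (complex^'n \<Rightarrow> real) \<Rightarrow> bool"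
where
  "strictly_pseudoconvex \<Omega> r \<longleftrightarrow>
     smooth_bounded_domain \<Omega> r \<and>
     (\<forall>\<alpha>\<in>frontier \<Omega>. \<forall>w\<in>complex_tangent_space r \<alpha>. w \<noteq> 0 \<longrightarrow> Re (levi_form r \<alpha> w) > 0)"

subsection \<open>Weighted Bergman spaces\<close>

text \<open>
  The measures \<open>m\<^sub>j\<close> on \<open>\<Omega>\<close>. The unit ball of \<open>\<complex>\<^sup>j\<close> has real dimension \<open>2 j\<close>. The
  case \<open>j = 0\<close> is plain Lebesgue measure, without the factor \<open>v\<^sub>1 = \<pi>\<close> that the general
  formula would give.
\<close>

definition weighted_measure ::
  "(complex^'n::finite) set \<Rightarrow> (complex^'n \<Rightarrow> real) \<Rightarrow> nat \<Rightarrow> (complex^'n) measure"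
where
  "weighted_measure \<Omega> r j =
     (if j = 0 then restrict_space lborel \<Omega>
      else density (restrict_space lborel \<Omega>)
             (\<lambda>z. ennreal (real (j + 1) * unit_ball_vol (real (2 * (j + 1))) * (- r z) ^ j)))"

text \<open>The \<open>p\<close>-th power of the norm of \<open>A\<^sup>p\<^sub>j(\<Omega>)\<close>, possibly infinite.\<close>

definition bergman_norm_pow ::
  "(complex^'n::finite) set \<Rightarrow> (complex^'n \<Rightarrow> real) \<Rightarrow> real \<Rightarrow> nat \<Rightarrow> (complex^'n \<Rightarrow> complex) \<Rightarrow> ennreal"
where
  "bergman_norm_pow \<Omega> r p j f = (\<integral>\<^sup>+ z. ennreal (cmod (f z) powr p) \<partial>weighted_measure \<Omega> r j)"

definition bergman_space ::
  "(complex^'n::finite) set \<Rightarrow> (complex^'n \<Rightarrow> real) \<Rightarrow> real \<Rightarrow> nat \<Rightarrow> (complex^'n \<Rightarrow> complex) set"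
where
  "bergman_space \<Omega> r p j =
     {f. holomorphic_several_on f \<Omega> \<and> bergman_norm_pow \<Omega> r p j f < \<infinity>}"

subsection \<open>The minimal good family of polydiscs\<close>

text \<open>
  The normal projection is the nearest point projection onto the boundary. As
  \<open>closest_point\<close> is a choice function, uniqueness of the nearest point is required
  separately.
\<close>

definition normal_projection_nbhd ::
  "(complex^'n::finite) set \<Rightarrow> (complex^'n) set \<Rightarrow> bool"
where
  "normal_projection_nbhd \<Omega> U \<longleftrightarrow>
     open U \<and> U \<subseteq> \<Omega> \<and> (\<exists>V. open V \<and> frontier \<Omega> \<subseteq> V \<and> V \<inter> \<Omega> \<subseteq> U) \<and>
     (\<forall>a\<in>U. \<exists>!q. q \<in> frontier \<Omega> \<and> (\<forall>y\<in>frontier \<Omega>. dist a q \<le> dist a y)) \<and>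
     smooth_on U (closest_point (frontier \<Omega>))"

definition hermitian_inner :: "complex^'n::finite \<Rightarrow> complex^'n \<Rightarrow> complex" where
  "hermitian_inner u v = (\<Sum>i\<in>UNIV. u $ i * cnj (v $ i))"

text \<open>Orthonormality makes both \<open>b\<close> and its part off \<open>\<iota>\<close> linearly independent.\<close>

definition adapted_basis ::
  "(complex^'n::finite \<Rightarrow> real) \<Rightarrow> complex^'n \<Rightarrow> 'n \<Rightarrow> ('n \<Rightarrow> complex^'n) \<Rightarrow> bool"
where
  "adapted_basis r \<alpha> \<iota> b \<longleftrightarrow>
     (\<forall>i j. hermitian_inner (b i) (b j) = (if i = j then 1 else 0)) \<and>
     vec.span (b ` (- {\<iota>})) = complex_tangent_space r \<alpha>"

text \<open>\<open>polydisc \<Omega> r U \<iota> L a t\<close> is \<open>P\<^sub>a(t)\<close>; \<open>L \<alpha>\<close> is the basis chosen at \<open>\<alpha> \<in> \<partial>\<Omega>\<close>.\<close>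

definition polydisc ::
  "(complex^'n::finite) set \<Rightarrow> (complex^'n \<Rightarrow> real) \<Rightarrow> (complex^'n) set \<Rightarrow> 'n \<Rightarrow>
   (complex^'n \<Rightarrow> 'n \<Rightarrow> complex^'n) \<Rightarrow> complex^'n \<Rightarrow> real \<Rightarrow> (complex^'n) set"
where
  "polydisc \<Omega> r U \<iota> L a t =
     (if a \<in> U then
        {a + (\<Sum>j\<in>UNIV. c j *s L (closest_point (frontier \<Omega>) a) j) | c.
           cmod (c \<iota>) < t * \<bar>r a\<bar> \<and> (\<forall>j. j \<noteq> \<iota> \<longrightarrow> cmod (c j) < t * sqrt \<bar>r a\<bar>)}
      else
        {z. cmod (z $ \<iota> - a $ \<iota>) < t * infdist a (- \<Omega>) \<and>
            (\<forall>j. j \<noteq> \<iota> \<longrightarrow> cmod (z $ j - a $ j) < t * sqrt (infdist a (- \<Omega>)))})"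

text \<open>The last condition is the normalization of \<open>r\<close>.\<close>

definition minimal_good_family ::
  "(complex^'n::finite) set \<Rightarrow> (complex^'n \<Rightarrow> real) \<Rightarrow> (complex^'n) set \<Rightarrow> 'n \<Rightarrow>
   (complex^'n \<Rightarrow> 'n \<Rightarrow> complex^'n) \<Rightarrow> bool"
where
  "minimal_good_family \<Omega> r U \<iota> L \<longleftrightarrow>
     normal_projection_nbhd \<Omega> U \<and>
     (\<forall>\<alpha>\<in>frontier \<Omega>. adapted_basis r \<alpha> \<iota> (L \<alpha>)) \<and>
     (\<forall>a\<in>U. \<not> polydisc \<Omega> r U \<iota> L a 2 \<subseteq> \<Omega>)"

subsection \<open>The Bergman-Carleson embedding property\<close>

text \<open>
  \<open>P a t\<close> is a family of polydiscs. A Borel measure on \<open>\<Omega>\<close> may take the value \<open>\<infinity>\<close>;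
  its space is \<open>\<Omega>\<close>, so integrals with respect to it are integrals over \<open>\<Omega>\<close>.
\<close>

definition borel_measure_on :: "'a::topological_space set \<Rightarrow> 'a measure \<Rightarrow> bool" where
  "borel_measure_on \<Omega> \<mu> \<longleftrightarrow> sets \<mu> = sets (restrict_space borel \<Omega>)"

definition bergman_carleson_measure ::
  "(complex^'n::finite) set \<Rightarrow> (complex^'n \<Rightarrow> real) \<Rightarrow> (complex^'n \<Rightarrow> real \<Rightarrow> (complex^'n) set) \<Rightarrow>
   nat \<Rightarrow> (complex^'n) measure \<Rightarrow> bool"
where
  "bergman_carleson_measure \<Omega> r P k \<mu> \<longleftrightarrow>
     borel_measure_on \<Omega> \<mu> \<and>
     (\<exists>C\<^sub>0>0. \<forall>a\<in>\<Omega>.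
        emeasure \<mu> (\<Omega> \<inter> P a 2) \<le>
          ennreal C\<^sub>0 * emeasure (weighted_measure \<Omega> r (k - 1)) (\<Omega> \<inter> P a 2))"

definition bergman_carleson_embedding ::
  "(complex^'n::finite) set \<Rightarrow> (complex^'n \<Rightarrow> real) \<Rightarrow> (complex^'n \<Rightarrow> real \<Rightarrow> (complex^'n) set) \<Rightarrow>
   real \<Rightarrow> nat \<Rightarrow> bool"
where
  "bergman_carleson_embedding \<Omega> r P p k \<longleftrightarrow>
     (\<forall>\<mu>. bergman_carleson_measure \<Omega> r P k \<mu> \<longrightarrow>
        (\<exists>C>0. \<forall>f\<in>bergman_space \<Omega> r p (k - 1).
           (\<integral>\<^sup>+ z. ennreal (cmod (f z) powr p) \<partial>\<mu>)
             \<le> ennreal C * bergman_norm_pow \<Omega> r p (k - 1) f))"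

end

theory Submission
  imports Defs "HOL-Complex_Analysis.Cauchy_Integral_Formula"
begin

text \<open>
  Let \<open>\<partial>r\<close> denote the complex linear form with real part \<open>dr\<close> and put
  \<open>B\<^sub>a(t) = {v. |\<partial>r\<^sub>a(v)| < t |r(a)|, |v| < t |r(a)|\<^sup>1\<^sup>/\<^sup>2}\<close>. Since \<open>\<partial>r\<close> is
  Lipschitz, the translates \<open>a + B\<^sub>a(t)\<close> behave like the balls of a quasi-metric, and for a small
  \<open>\<epsilon>\<close> they satisfy \<open>a + B\<^sub>a(\<epsilon>) \<subseteq> \<Omega>\<close>, with \<open>|r| \<simeq> |r(a)|\<close> there, and
  \<open>z \<in> a + B\<^sub>a(\<epsilon>)\<close> implies \<open>a \<in> P\<^sub>z(2)\<close>, while \<open>P\<^sub>z(2) \<inter> \<Omega> \<subseteq> z + B\<^sub>z(T)\<close> for a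
  large \<open>T\<close>. As \<open>B\<^sub>a(t) = t B\<^sub>a(1)\<close>, all the volumes involved are comparable without being
  computed. The set \<open>B\<^sub>a(\<epsilon>)\<close> is invariant under \<open>v \<mapsto> e\<^sup>i\<^sup>\<theta> v\<close>, so the one-variable mean value
  property on complex lines gives \<open>|f(a)|\<^sup>p |B\<^sub>a(\<epsilon>)| \<le> \<integral> |f|\<^sup>p\<close> over \<open>a + B\<^sub>a(\<epsilon>)\<close>. Integrating
  this against \<open>\<mu>\<close> and exchanging the integrals, the Carleson condition bounds the \<open>\<mu>\<close>-measure of
  \<open>{a. z \<in> a + B\<^sub>a(\<epsilon>)} \<subseteq> P\<^sub>z(2)\<close>.
\<close>

subsection \<open>Invariance of Lebesgue measure\<close>

lemma emeasure_lborel_translate: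
  fixes a :: "'a::euclidean_space"
  assumes "A \<in> sets borel"
  shows "emeasure lborel {z. z - a \<in> A} = emeasure lborel A"
proof -
  have "emeasure lborel A = emeasure (distr lborel borel ((+) (- a))) A"
    by (simp add: lborel_distr_plus)
  also have "\<dots> = emeasure lborel ((+) (- a) -` A)"
    using assms by (subst emeasure_distr) auto
  also have "(+) (- a) -` A = {z. z - a \<in> A}" by auto
  finally show ?thesis by simp
qed

lemma nn_integral_lborel_translate:
  fixes a :: "'a::euclidean_space"
  assumes [measurable]: "g \<in> borel_measurable borel"
  shows "(\<integral>\<^sup>+ v. g (a + v) \<partial>lborel) = (\<integral>\<^sup>+ z. g z \<partial>lborel)"
proof -
  have "(\<integral>\<^sup>+ z. g z \<partial>lborel) = (\<integral>\<^sup>+ z. g z \<partial>distr lborel borel ((+) a))"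
    by (simp add: lborel_distr_plus)
  also have "\<dots> = (\<integral>\<^sup>+ v. g (a + v) \<partial>lborel)"
    by (rule nn_integral_distr) measurable
  finally show ?thesis by simp
qed

lemma orthogonal_transformation_vimage_ball:
  fixes T :: "'a::euclidean_space \<Rightarrow> 'a"
  assumes "orthogonal_transformation T"
  shows "T -` ball (T x) e = ball x e"
proof -
  have "dist (T x) (T y) = dist x y" for y
    using assms by (metis dist_norm linear_diff orthogonal_transformation)
  then show ?thesis by auto
qed

lemma emeasure_lborel_ball_eq:
  fixes x y :: "'a::euclidean_space"
  shows "emeasure lborel (ball x e) = emeasure lborel (ball y e)"
proof -
  have "ball x e = {z. z - (x - y) \<in> ball y e}" by (auto simp: dist_norm algebra_simps)
  then show ?thesis by (simp only: emeasure_lborel_translate[OF borel_open[OF open_ball]])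
qed

text \<open>Vitali's theorem fills the open set with disjoint balls up to a null set, and the
  preimage of a ball under an isometry is a ball of the same radius. Only an inequality comes out,
  because the preimage of the null remainder is not yet known to be null.\<close>

lemma emeasure_open_le_orthogonal_vimage:
  fixes T :: "'a::euclidean_space \<Rightarrow> 'a"
  assumes T: "orthogonal_transformation T" and S: "open S"
  shows "emeasure lborel S \<le> emeasure lborel (T -` S)"
proof -
  define K where "K = {(x, e). 0 < e \<and> ball x e \<subseteq> S}"
  obtain C where C: "countable C" "C \<subseteq> K"
    and disj: "pairwise (\<lambda>i j. disjnt (ball (fst i) (snd i)) (ball (fst j) (snd j))) C"
    and negl: "negligible (S - (\<Union>i \<in> C. ball (fst i) (snd i)))"
  proof (rule Vitali_covering_theorem_balls[where S = S and K = K and a = fst and r = snd])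
    fix x d assume "x \<in> S" "0 < (d::real)"
    then obtain e where "e > 0" "ball x e \<subseteq> S" using S open_contains_ball by blast
    \<comment> \<open>Halving \<open>d\<close> makes the radius strictly smaller than
      \<open>d\<close>, as the covering theorem demands.\<close>
    then have "(x, min e (d/2)) \<in> K" using \<open>0 < d\<close> by (auto simp: K_def)
    then show "\<exists>i. i \<in> K \<and> x \<in> ball (fst i) (snd i) \<and> snd i < d"
      using \<open>0 < d\<close> \<open>e > 0\<close> by (intro exI[of _ "(x, min e (d/2))"]) auto
  qed
  define V where "V = (\<Union>i \<in> C. ball (fst i) (snd i))"
  have "V \<subseteq> S" using C(2) by (force simp: V_def K_def)
  have contT: "continuous_on UNIV T"
    using T by (simp add: linear_continuous_on linear_linear orthogonal_transformation_linear)
  have "open V" unfolding V_def by auto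
  have "open (T -` V)" "open (T -` S)" by (auto intro!: open_vimage contT S \<open>open V\<close>)
  have "emeasure lborel (S - V) = 0"
    using negl S \<open>open V\<close> unfolding V_def[symmetric]
    by (subst (asm) negligible_iff_emeasure0) auto
  moreover have "S = V \<union> (S - V)" using \<open>V \<subseteq> S\<close> by auto
  ultimately have "emeasure lborel S \<le> emeasure lborel V"
    using S \<open>open V\<close> emeasure_subadditive[of V lborel "S - V"] by auto
  also have "emeasure lborel V = (\<integral>\<^sup>+ i. emeasure lborel (ball (fst i) (snd i)) \<partial>count_space C)"
    unfolding V_def using C(1) disj
    by (intro emeasure_UN_countable) (auto simp: disjoint_family_on_def pairwise_def disjnt_def)
  also have "\<dots> = (\<integral>\<^sup>+ i. emeasure lborel (T -` ball (fst i) (snd i)) \<partial>count_space C)"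
  proof (intro nn_integral_cong)
    fix i :: "'a \<times> real"
    obtain x where x: "fst i = T x" using orthogonal_transformation_surj[OF T] by (metis surjD)
    show "emeasure lborel (ball (fst i) (snd i)) = emeasure lborel (T -` ball (fst i) (snd i))"
      unfolding x orthogonal_transformation_vimage_ball[OF T] by (rule emeasure_lborel_ball_eq)
  qed
  also have "\<dots> = emeasure lborel (\<Union>i \<in> C. T -` ball (fst i) (snd i))"
  proof (intro emeasure_UN_countable[symmetric])
    show "disjoint_family_on (\<lambda>i. T -` ball (fst i) (snd i)) C"
      using disj by (fastforce simp: disjoint_family_on_def pairwise_def disjnt_def)
  qed (use C(1) in \<open>auto intro!: borel_open open_vimage contT\<close>)
  also have "\<dots> \<le> emeasure lborel (T -` S)"
    using \<open>V \<subseteq> S\<close> \<open>open (T -` S)\<close> unfolding V_def by (intro emeasure_mono) auto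
  finally show ?thesis .
qed

text \<open>Boxes determine Lebesgue measure, and on them the one-sided inequality, applied to
  \<open>T\<close> and to \<open>inv T\<close>, gives equality.\<close>

lemma lborel_distr_orthogonal_transformation:
  fixes T :: "'a::euclidean_space \<Rightarrow> 'a"
  assumes T: "orthogonal_transformation T"
  shows "distr lborel borel T = lborel"
proof (rule lborel_eqI[symmetric])
  fix l u :: 'a
  assume le: "\<And>b. b \<in> Basis \<Longrightarrow> l \<bullet> b \<le> u \<bullet> b"
  have T': "orthogonal_transformation (inv T)" using T by (rule orthogonal_transformation_inv)
  have contT: "continuous_on UNIV T"
    using T by (simp add: linear_continuous_on linear_linear orthogonal_transformation_linear)
  have "emeasure (distr lborel borel T) (box l u) = emeasure lborel (T -` box l u)"
    using contT by (subst emeasure_distr) (auto intro: borel_measurable_continuous_onI)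
  also have "\<dots> = emeasure lborel (box l u)"
  proof (rule antisym)
    have "open (T -` box l u)" using contT by (intro open_vimage) auto
    from emeasure_open_le_orthogonal_vimage[OF T' this]
    have "emeasure lborel (T -` box l u) \<le> emeasure lborel (inv T -` T -` box l u)" .
    also have "inv T -` T -` box l u = box l u"
      using orthogonal_transformation_surj[OF T] by (auto simp: surj_f_inv_f)
    finally show "emeasure lborel (T -` box l u) \<le> emeasure lborel (box l u)" .
  qed (intro emeasure_open_le_orthogonal_vimage T open_box)
  finally show "emeasure (distr lborel borel T) (box l u) = (\<Prod>b\<in>Basis. (u - l) \<bullet> b)"
    using le by (simp add: emeasure_lborel_box inner_diff_left)
qed simp

subsection \<open>The submean value property\<close>

lemma norm_vector_scalar_mult:
  fixes v :: "complex^'n"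
  shows "norm (c *s v) = cmod c * norm v"
  by (simp add: norm_vec_def norm_mult L2_set_right_distrib)

lemma linear_vector_scalar_mult: "linear ((*s) (c::complex) :: complex^'n \<Rightarrow> complex^'n)"
  by (rule linearI) (auto simp: vec_eq_iff algebra_simps)

lemma orthogonal_transformation_unimodular:
  "cmod c = 1 \<Longrightarrow> orthogonal_transformation ((*s) c :: complex^'n \<Rightarrow> complex^'n)"
  by (simp add: orthogonal_transformation linear_vector_scalar_mult norm_vector_scalar_mult)

lemma powr_ge_tangent:
  fixes x y p :: real
  assumes "x \<ge> 0" "y > 0" "p \<ge> 1"
  shows "x powr p \<ge> y powr p + p * y powr (p - 1) * (x - y)"
\<comment> \<open>Convexity is used on the open half-line, so the endpoint 0 is checked by hand:
  there the claim reads y^p (1 - p) \<le> 0.\<close>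
proof (cases "x = 0")
  case True
  have "y powr p = y powr (p - 1) * y" using assms by (simp add: powr_mult_base' powr_diff)
  moreover have "y powr (p - 1) * y * (1 - p) \<le> 0" using assms by (intro mult_nonneg_nonpos) auto
  ultimately show ?thesis using True assms by (simp add: algebra_simps)
next
  case False
  have "x powr p - y powr p \<ge> p * y powr (p - 1) * (x - y)"
    using assms False
    by (intro convex_on_imp_above_tangent[where A = "{0<..}"] powr_convex)
       (auto intro!: derivative_eq_intros simp: interior_open)
  then show ?thesis by simp
qed

text \<open>Jensen's inequality for the mean value property, by integrating the tangent line inequality.\<close>

lemma cmod_powr_le_circle_mean:
  fixes p :: real
  assumes g: "g holomorphic_on cball 0 1" and p: "p \<ge> 1"
  shows "ennreal (cmod (g 0) powr p)
           \<le> (\<integral>\<^sup>+ t. indicator {0..1} t * ennreal (cmod (g (exp (2 * of_real pi * \<i> * of_real t))) powr p) \<partial>lborel)"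
proof (cases "g 0 = 0")
  case True
  then show ?thesis by simp
next
  case False
  define c where "c = cmod (g 0)"
  \<comment> \<open>A rotation taking \<open>g 0\<close> to the positive real \<open>c\<close>, so
    that Re (u g) has mean \<open>c\<close> on the circle and stays below |g|.\<close>
  define u where "u = cnj (g 0) / of_real c"
  define e where "e t = exp (2 * of_real pi * \<i> * complex_of_real t)" for t
  define h where "h t = cmod (g (e t)) powr p" for t
  have c: "c > 0" using False by (simp add: c_def)
  have ug: "u * g 0 = of_real c"
    using c complex_norm_square[of "g 0"] by (simp add: u_def c_def power2_eq_square field_simps)
  have nu: "cmod u = 1" using c by (simp add: u_def norm_divide c_def)
  have ne: "cmod (e t) = 1" for t by (simp add: e_def)
  \<comment> \<open>Cauchy's formula at the center; with the circle parametrized by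
    \<open>{0..1}\<close> the factor \<open>e t\<close> cancels and the mean value property
    remains.\<close>
  have "((\<lambda>z. g z / (z - 0)) has_contour_integral (2 * of_real pi * \<i> * g 0)) (circlepath 0 1)"
    using g by (intro Cauchy_integral_circlepath_simple) auto
  then have "((\<lambda>t. g (e t) / e t * (2 * pi * \<i> * e t)) has_integral (2 * of_real pi * \<i> * g 0)) {0..1}"
    unfolding has_contour_integral_def
  proof (rule has_integral_eq[rotated])
    fix t :: real assume t: "t \<in> {0..1}"
    have "circlepath 0 1 t = e t" by (simp add: circlepath e_def)
    moreover have "vector_derivative (circlepath 0 1) (at t within {0..1}) = 2 * pi * \<i> * e t"
      using t vector_derivative_circlepath01[of t 0 1] by (simp add: e_def)
    ultimately show "g (circlepath 0 1 t) / (circlepath 0 1 t - 0) * vector_derivative (circlepath 0 1) (at t within {0..1})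
        = g (e t) / e t * (2 * pi * \<i> * e t)" by simp
  qed
  then have "((\<lambda>t. (1 / (2 * pi * \<i>)) * (g (e t) / e t * (2 * pi * \<i> * e t))) has_integral
      ((1 / (2 * pi * \<i>)) * (2 * of_real pi * \<i> * g 0))) {0..1}"
    by (rule has_integral_mult_right)
  then have "((\<lambda>t. g (e t)) has_integral g 0) {0..1}"
    using ne by (simp add: e_def)
  then have "((\<lambda>t. u * g (e t)) has_integral (u * g 0)) {0..1}"
    by (rule has_integral_mult_right)
  then have "((\<lambda>t. Re (u * g (e t))) has_integral c) {0..1}"
    unfolding ug using has_integral_Re by force
  moreover have const: "((\<lambda>_. x) has_integral x) {0..1::real}" for x :: real
    using has_integral_const_real[of x 0 1] by simp
  ultimately have 1: "((\<lambda>t. c powr p + p * c powr (p - 1) * (Re (u * g (e t)) - c)) has_integral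
       c powr p + p * c powr (p - 1) * (c - c)) {0..1}"
    by (intro has_integral_add has_integral_mult_right has_integral_diff const)
  have "continuous_on {0..1} (\<lambda>t. g (e t))"
    by (rule continuous_on_compose2[OF holomorphic_on_imp_continuous_on[OF g]])
       (auto simp: ne, auto simp: e_def intro!: continuous_intros)
  then have "continuous_on {0..1} h"
    unfolding h_def using p by (intro continuous_on_powr' continuous_intros) auto
  then have 2: "(h has_integral (integral {0..1} h)) {0..1}"
    by (intro integrable_integral integrable_continuous_real)
  \<comment> \<open>The tangent line to x^p at \<open>c\<close>, evaluated at Re (u g), integrates
    to exactly c^p because its linear part has mean zero.\<close>
  have "c powr p \<le> integral {0..1} h"
  proof (rule has_integral_le[OF _ 2])
    show "((\<lambda>t. c powr p + p * c powr (p - 1) * (Re (u * g (e t)) - c)) has_integral c powr p) {0..1}"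
      using 1 by (simp only: diff_self mult_zero_right add_0_right)
    fix t
    have "Re (u * g (e t)) \<le> cmod (g (e t))"
      using complex_Re_le_cmod[of "u * g (e t)"] nu by (simp add: norm_mult)
    then have "p * c powr (p - 1) * (Re (u * g (e t)) - c) \<le> p * c powr (p - 1) * (cmod (g (e t)) - c)"
      using p by (intro mult_left_mono) auto
    also have "c powr p + \<dots> \<le> h t"
      unfolding h_def using c p by (intro powr_ge_tangent) auto
    finally show "c powr p + p * c powr (p - 1) * (Re (u * g (e t)) - c) \<le> h t" by simp
  qed
  moreover have "(\<integral>\<^sup>+ t. ennreal (indicator {0..1} t * h t) \<partial>lborel) = ennreal (integral {0..1} h)"
    by (rule nn_integral_has_integral_lebesgue[OF _ 2]) (simp add: h_def)
  moreover have "(\<integral>\<^sup>+ t. indicator {0..1} t * ennreal (h t) \<partial>lborel) = (\<integral>\<^sup>+ t. ennreal (indicator {0..1} t * h t) \<partial>lborel)"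
    by (intro nn_integral_cong) (auto simp: indicator_def)
  ultimately show ?thesis by (simp add: c_def h_def e_def ennreal_leI)
qed

lemma continuous_on_cmod_powr:
  fixes f :: "'a::topological_space \<Rightarrow> complex" and p :: real
  assumes "continuous_on S f" "p \<ge> 1"
  shows "continuous_on S (\<lambda>z. cmod (f z) powr p)"
  using assms by (intro continuous_on_powr' continuous_on_norm continuous_on_const) auto

text \<open>Extension by 0 makes the function measurable on the whole space, whatever its values off
  \<open>S\<close>.\<close>

lemma borel_measurable_indicator_times_ennreal:
  fixes g :: "'a::topological_space \<Rightarrow> real"
  assumes "continuous_on S g" "S \<in> sets borel"
  shows "(\<lambda>z. indicator S z * ennreal (g z)) \<in> borel_measurable borel"
proof -
  have "(\<lambda>z. indicator S z *\<^sub>R g z) \<in> borel_measurable borel"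
    using assms by (intro borel_measurable_continuous_on_indicator)
  then have "(\<lambda>z. ennreal (indicator S z *\<^sub>R g z)) \<in> borel_measurable borel"
    by measurable
  also have "(\<lambda>z. ennreal (indicator S z *\<^sub>R g z)) = (\<lambda>z. indicator S z * ennreal (g z))"
    by (auto simp: indicator_def)
  finally show ?thesis .
qed

section \<open>Passage from one variable to several along complex lines\<close>

lemma holomorphic_several_on_imp_continuous_on:
  "holomorphic_several_on f S \<Longrightarrow> continuous_on S f"
  unfolding holomorphic_several_on_def
  by (meson continuous_at_imp_continuous_on has_derivative_continuous)

text \<open>By the chain rule the real derivative in the complex parameter is
  \<open>D (\<zeta> *s v)\<close>, and complex homogeneity of \<open>D\<close> makes this
  multiplication by \<open>D v\<close>.\<close>

lemma holomorphic_several_on_complex_line: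
  assumes f: "holomorphic_several_on f S" and sub: "\<And>\<zeta>. \<zeta> \<in> A \<Longrightarrow> a + \<zeta> *s v \<in> S"
  shows "(\<lambda>\<zeta>. f (a + \<zeta> *s v)) holomorphic_on A"
proof -
  have "\<exists>D. ((\<lambda>\<zeta>. f (a + \<zeta> *s v)) has_field_derivative D) (at \<zeta> within A)" if \<zeta>: "\<zeta> \<in> A" for \<zeta>
  proof -
    obtain D where D: "(f has_derivative D) (at (a + \<zeta> *s v))" and lin: "\<And>c w. D (c *s w) = c * D w"
      using f sub[OF \<zeta>] unfolding holomorphic_several_on_def by blast
    have bl: "bounded_linear (\<lambda>\<zeta>. \<zeta> *s v)"
      by (intro linear_conv_bounded_linear[THEN iffD1] linearI) (auto simp: vec_eq_iff algebra_simps)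
    have "((\<lambda>\<zeta>. a + \<zeta> *s v) has_derivative (\<lambda>\<zeta>. \<zeta> *s v)) (at \<zeta> within A)"
      using bounded_linear_imp_has_derivative[OF bl] by (auto intro!: derivative_eq_intros)
    then have "((\<lambda>\<zeta>. f (a + \<zeta> *s v)) has_derivative (\<lambda>\<zeta>. D (\<zeta> *s v))) (at \<zeta> within A)"
      using D by (rule has_derivative_compose)
    then have "((\<lambda>\<zeta>. f (a + \<zeta> *s v)) has_field_derivative D v) (at \<zeta> within A)"
      by (simp add: has_field_derivative_def lin mult.commute[of _ "D v"])
    then show ?thesis by blast
  qed
  then show ?thesis by (auto simp: holomorphic_on_def field_differentiable_def)
qed

text \<open>
  Averaging the one-variable inequality along the circles \<open>e\<^sup>i\<^sup>\<theta> v\<close>; each rotation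
  preserves both \<open>B\<close> and Lebesgue measure.
\<close>

proposition submean_value_circular:
  fixes f :: "complex^'n \<Rightarrow> complex" and p :: real
  assumes f: "holomorphic_several_on f S" and p: "p \<ge> 1"
    and B: "open B" and bal: "\<And>c v. cmod c \<le> 1 \<Longrightarrow> v \<in> B \<Longrightarrow> c *s v \<in> B"
    and sub: "\<And>v. v \<in> B \<Longrightarrow> a + v \<in> S"
  shows "ennreal (cmod (f a) powr p) * emeasure lborel B
           \<le> (\<integral>\<^sup>+ v. indicator B v * ennreal (cmod (f (a + v)) powr p) \<partial>lborel)"
proof -
  define e where "e t = exp (2 * of_real pi * \<i> * complex_of_real t)" for t
  define F where "F v = indicator B v * ennreal (cmod (f (a + v)) powr p)" for v
  have ne: "cmod (e t) = 1" for t by (simp add: e_def)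
  have inB: "e t *s v \<in> B \<longleftrightarrow> v \<in> B" for t v
  proof
    assume "e t *s v \<in> B"
    then have "(1 / e t) *s (e t *s v) \<in> B" by (intro bal[of "1 / e t" "e t *s v"]) (auto simp: norm_divide ne)
    moreover have "e t \<noteq> 0" by (simp add: e_def)
    ultimately show "v \<in> B" by (simp add: vector_smult_assoc vector_smult_lid)
  qed (use bal ne in auto)
  have "continuous_on B (\<lambda>v. f (a + v))"
    by (rule continuous_on_compose2[OF holomorphic_several_on_imp_continuous_on[OF f]])
       (auto intro!: continuous_intros sub)
  then have [measurable]: "F \<in> borel_measurable borel"
    unfolding F_def using B p by (intro borel_measurable_indicator_times_ennreal continuous_on_cmod_powr) auto
  have [measurable]: "(\<lambda>(v, t). e t *s v) \<in> borel_measurable (borel \<Otimes>\<^sub>M borel)"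
    unfolding borel_prod e_def case_prod_beta
    by (intro borel_measurable_continuous_onI)
       (simp add: vector_scalar_mult_def, intro continuous_intros)
  have "ennreal (cmod (f a) powr p) * emeasure lborel B
      = (\<integral>\<^sup>+ v. ennreal (cmod (f a) powr p) * indicator B v \<partial>lborel)"
    using B by (simp add: nn_integral_cmult_indicator)
  also have "\<dots> \<le> (\<integral>\<^sup>+ v. (\<integral>\<^sup>+ t. indicator {0..1} t * F (e t *s v) \<partial>lborel) \<partial>lborel)"
  proof (intro nn_integral_mono)
    fix v
    show "ennreal (cmod (f a) powr p) * indicator B v \<le> (\<integral>\<^sup>+ t. indicator {0..1} t * F (e t *s v) \<partial>lborel)"
    proof (cases "v \<in> B")
      case True
      \<comment> \<open>The point \<open>a\<close> has parameter 0 on the line through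
        \<open>a\<close> in direction \<open>v\<close>; \<open>bal\<close> and \<open>sub\<close>
        keep the closed unit disc of parameters inside \<open>S\<close>.\<close>
      have "ennreal (cmod (f (a + 0 *s v)) powr p) \<le>
         (\<integral>\<^sup>+ t. indicator {0..1} t * ennreal (cmod (f (a + e t *s v)) powr p) \<partial>lborel)"
        unfolding e_def using True
        by (intro cmod_powr_le_circle_mean p holomorphic_several_on_complex_line[OF f] sub bal) auto
      then show ?thesis using True by (simp add: F_def inB)
    qed simp
  qed
  also have "\<dots> = (\<integral>\<^sup>+ t. (\<integral>\<^sup>+ v. indicator {0..1} t * F (e t *s v) \<partial>lborel) \<partial>lborel)"
    by (rule lborel_pair.Fubini') measurable
  also have "\<dots> = (\<integral>\<^sup>+ t. indicator {0..1::real} t * (\<integral>\<^sup>+ v. F v \<partial>lborel) \<partial>lborel)"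
  proof (intro nn_integral_cong)
    fix t :: real
    have [measurable]: "(*s) (e t) \<in> borel_measurable borel"
      by (intro borel_measurable_continuous_onI linear_continuous_on
            linear_conv_bounded_linear[THEN iffD1] linear_vector_scalar_mult)
    \<comment> \<open>Rotating the inner integral removes its dependence on
      \<open>t\<close>.\<close>
    have "(\<integral>\<^sup>+ v. F v \<partial>lborel) = (\<integral>\<^sup>+ v. F v \<partial>distr lborel borel ((*s) (e t)))"
      by (simp add: lborel_distr_orthogonal_transformation orthogonal_transformation_unimodular ne)
    also have "\<dots> = (\<integral>\<^sup>+ v. F (e t *s v) \<partial>lborel)"
      by (rule nn_integral_distr) measurable
    finally show "(\<integral>\<^sup>+ v. indicator {0..1} t * F (e t *s v) \<partial>lborel) = indicator {0..1} t * (\<integral>\<^sup>+ v. F v \<partial>lborel)"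
      by (subst nn_integral_cmult) auto
  qed
  also have "\<dots> = (\<integral>\<^sup>+ v. F v \<partial>lborel)"
    by (subst nn_integral_multc) auto
  finally show ?thesis by (simp add: F_def)
qed

subsection \<open>Smooth defining functions and adapted bases\<close>

lemma smooth_on_imp_C2:
  assumes "smooth_on UNIV f"
  shows "f differentiable (at x)"
    and "(\<lambda>x. frechet_derivative f (at x) v) differentiable (at x)"
    and "continuous_on UNIV (\<lambda>x. frechet_derivative (\<lambda>x. frechet_derivative f (at x) v) (at x) w)"
proof -
  have "Ck_on (Suc (Suc 0)) UNIV f" using assms by (auto simp: smooth_on_def)
  then show "f differentiable (at x)"
    and "(\<lambda>x. frechet_derivative f (at x) v) differentiable (at x)"
    and "continuous_on UNIV (\<lambda>x. frechet_derivative (\<lambda>x. frechet_derivative f (at x) v) (at x) w)"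
    by auto
qed

text \<open>Unlike the operator norm, the sum over \<open>Basis\<close> is visibly continuous when
  the form varies continuously with a point, so compactness can be applied to it.\<close>

lemma linear_abs_le_sum_Basis:
  fixes h :: "'a::euclidean_space \<Rightarrow> real"
  assumes "linear h"
  shows "\<bar>h v\<bar> \<le> (\<Sum>b\<in>Basis. \<bar>h b\<bar>) * norm v"
proof -
  have "h v = h (\<Sum>b\<in>Basis. (v \<bullet> b) *\<^sub>R b)" by (simp add: euclidean_representation)
  also have "\<dots> = (\<Sum>b\<in>Basis. (v \<bullet> b) * h b)" by (simp add: linear_sum linear_scale assms)
  also have "\<bar>\<dots>\<bar> \<le> (\<Sum>b\<in>Basis. \<bar>(v \<bullet> b) * h b\<bar>)" by (rule sum_abs)
  also have "\<dots> \<le> (\<Sum>b\<in>Basis. norm v * \<bar>h b\<bar>)"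
    by (intro sum_mono) (auto simp: abs_mult intro!: mult_right_mono Basis_le_norm)
  finally show ?thesis by (simp add: sum_distrib_left mult.commute)
qed

text \<open>Compactness bounds the first and second partial derivatives. Convexity keeps connecting
  segments inside \<open>S\<close>, where the mean value inequality turns the second-order bound
  into a Lipschitz bound for the differential and then into a quadratic Taylor remainder.\<close>

lemma smooth_on_compact_convex_estimates:
  fixes f :: "'a::euclidean_space \<Rightarrow> real"
  assumes f: "smooth_on UNIV f" and S: "compact S" "convex S"
  obtains K where "K \<ge> 0"
    "\<And>x v. x \<in> S \<Longrightarrow> \<bar>frechet_derivative f (at x) v\<bar> \<le> K * norm v"
    "\<And>x y v. x \<in> S \<Longrightarrow> y \<in> S \<Longrightarrow>
       \<bar>frechet_derivative f (at x) v - frechet_derivative f (at y) v\<bar> \<le> K * norm (x - y) * norm v"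
    "\<And>x y. x \<in> S \<Longrightarrow> y \<in> S \<Longrightarrow>
       \<bar>f y - f x - frechet_derivative f (at x) (y - x)\<bar> \<le> K * (norm (y - x))\<^sup>2"
proof -
  define D where "D x = frechet_derivative f (at x)" for x
  define H where "H x b = frechet_derivative (\<lambda>x. D x b) (at x)" for x b
  have D: "(f has_derivative D x) (at x)" for x
    unfolding D_def using smooth_on_imp_C2(1)[OF f] frechet_derivative_works by blast
  have H: "((\<lambda>x. D x b) has_derivative H x b) (at x)" for x b
    unfolding H_def D_def using smooth_on_imp_C2(2)[OF f] frechet_derivative_works by blast
  have linD: "linear (D x)" for x using D has_derivative_linear by blast
  have linH: "linear (H x b)" for x b using H has_derivative_linear by blast
  have contH: "continuous_on UNIV (\<lambda>x. H x b w)" for b w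
    unfolding H_def D_def by (rule smooth_on_imp_C2(3)[OF f])
  have contD: "continuous_on UNIV (\<lambda>x. D x b)" for b
    by (intro continuous_at_imp_continuous_on ballI has_derivative_continuous[OF H])
  have "continuous_on S (\<lambda>x. \<Sum>b\<in>Basis. \<bar>D x b\<bar>)"
    by (intro continuous_intros continuous_on_subset[OF contD]) auto
  then have "bounded ((\<lambda>x. \<Sum>b\<in>Basis. \<bar>D x b\<bar>) ` S)"
    using S compact_continuous_image compact_imp_bounded by blast
  then obtain M1 where M1: "\<And>x. x \<in> S \<Longrightarrow> (\<Sum>b\<in>Basis. \<bar>D x b\<bar>) \<le> M1"
    unfolding bounded_iff by (metis abs_le_D1 imageI real_norm_def)
  have "continuous_on S (\<lambda>x. \<Sum>b\<in>Basis. \<Sum>w\<in>Basis. \<bar>H x b w\<bar>)"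
    by (intro continuous_intros continuous_on_subset[OF contH]) auto
  then have "bounded ((\<lambda>x. \<Sum>b\<in>Basis. \<Sum>w\<in>Basis. \<bar>H x b w\<bar>) ` S)"
    using S compact_continuous_image compact_imp_bounded by blast
  then obtain M2 where M2: "\<And>x. x \<in> S \<Longrightarrow> (\<Sum>b\<in>Basis. \<Sum>w\<in>Basis. \<bar>H x b w\<bar>) \<le> M2"
    unfolding bounded_iff by (metis abs_le_D1 imageI real_norm_def)
  have lip: "\<bar>D x b - D y b\<bar> \<le> M2 * norm (x - y)" if "x \<in> S" "y \<in> S" "b \<in> Basis" for x y b
  proof -
    have "norm (D x b - D y b) \<le> M2 * norm (x - y)"
    proof (rule differentiable_bound[OF S(2)])
      show "((\<lambda>x. D x b) has_derivative H u b) (at u within S)" if "u \<in> S" for u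
        using H has_derivative_at_withinI by blast
      show "onorm (H u b) \<le> M2" if u: "u \<in> S" for u
      proof (rule onorm_le)
        fix v
        have "\<bar>H u b v\<bar> \<le> (\<Sum>w\<in>Basis. \<bar>H u b w\<bar>) * norm v"
          by (rule linear_abs_le_sum_Basis[OF linH])
        also have "(\<Sum>w\<in>Basis. \<bar>H u b w\<bar>) \<le> (\<Sum>b\<in>Basis. \<Sum>w\<in>Basis. \<bar>H u b w\<bar>)"
          using \<open>b \<in> Basis\<close> by (intro member_le_sum sum_nonneg) auto
        also have "\<dots> \<le> M2" by (rule M2[OF u])
        finally show "norm (H u b v) \<le> M2 * norm v" by (simp add: mult_right_mono)
      qed
    qed fact+
    then show ?thesis by simp
  qed
  \<comment> \<open>The dimension enters because the Lipschitz bound is obtained on each basis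
    vector and then summed. The absolute values guard against negative \<open>M1\<close> and
    \<open>M2\<close>, possible when \<open>S\<close> is empty.\<close>
  define K where "K = \<bar>M1\<bar> + DIM('a) * \<bar>M2\<bar>"
  have K0: "K \<ge> 0" "M1 \<le> K" "DIM('a) * M2 \<le> K" 
  proof -
    have "DIM('a) * M2 \<le> DIM('a) * \<bar>M2\<bar>" "0 \<le> DIM('a) * \<bar>M2\<bar>"
      by (auto intro: mult_left_mono)
    then show "K \<ge> 0" "M1 \<le> K" "DIM('a) * M2 \<le> K" unfolding K_def by linarith+
  qed
  show ?thesis
  proof (rule that[OF K0(1)])
    fix x v assume "x \<in> S"
    have "\<bar>D x v\<bar> \<le> (\<Sum>b\<in>Basis. \<bar>D x b\<bar>) * norm v" by (rule linear_abs_le_sum_Basis[OF linD])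
    also have "\<dots> \<le> K * norm v"
      using M1[OF \<open>x \<in> S\<close>] K0 by (intro mult_right_mono) auto
    finally show "\<bar>frechet_derivative f (at x) v\<bar> \<le> K * norm v" by (simp add: D_def)
  next
    have lipD: "\<bar>D x v - D y v\<bar> \<le> K * norm (x - y) * norm v" if "x \<in> S" "y \<in> S" for x y v
    proof -
      have "\<bar>D x v - D y v\<bar> \<le> (\<Sum>b\<in>Basis. \<bar>D x b - D y b\<bar>) * norm v"
        by (rule linear_abs_le_sum_Basis[OF linear_compose_sub[OF linD linD]])
      also have "\<dots> \<le> (\<Sum>b\<in>(Basis::'a set). M2 * norm (x - y)) * norm v"
        using lip that by (intro mult_right_mono sum_mono) auto
      also have "\<dots> = (DIM('a) * M2) * norm (x - y) * norm v" by simp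
      also have "\<dots> \<le> K * norm (x - y) * norm v"
        using K0 by (intro mult_right_mono) auto
      finally show ?thesis .
    qed
    show "\<bar>frechet_derivative f (at x) v - frechet_derivative f (at y) v\<bar> \<le> K * norm (x - y) * norm v"
      if "x \<in> S" "y \<in> S" for x y v
      using lipD[OF that] by (simp add: D_def)
    fix x y assume x: "x \<in> S" and y: "y \<in> S"
    have seg: "closed_segment x y \<subseteq> S" using x y S(2) closed_segment_subset by blast
    \<comment> \<open>The linearization error at \<open>x\<close> is bounded by the oscillation of
      the differential along the segment, which is at most \<open>K * norm (y - x)\<close>.\<close>
    have "norm (f y - f x - D x (y - x)) \<le> norm (y - x) * (K * norm (y - x))"
    proof (rule differentiable_bound_linearization[where S = "closed_segment x y"])
      show "x + t *\<^sub>R (y - x) \<in> closed_segment x y" if "t \<in> {0..1}" for t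
        using that by (auto simp: closed_segment_def algebra_simps intro!: exI[of _ t])
      show "(f has_derivative D u) (at u within closed_segment x y)" for u
        using D has_derivative_at_withinI by blast
      show "onorm (D u - D x) \<le> K * norm (y - x)" if u: "u \<in> closed_segment x y" for u
      proof (rule onorm_le)
        fix v
        have "\<bar>D u v - D x v\<bar> \<le> K * norm (u - x) * norm v" using lipD u seg x by auto
        also have "\<dots> \<le> K * norm (y - x) * norm v"
          using K0 segment_bound1[OF u] by (intro mult_right_mono mult_left_mono) (auto simp: norm_minus_commute)
        finally show "norm ((D u - D x) v) \<le> K * norm (y - x) * norm v" by simp
      qed
    qed auto
    then show "\<bar>f y - f x - frechet_derivative f (at x) (y - x)\<bar> \<le> K * (norm (y - x))\<^sup>2"
      by (simp add: D_def power2_eq_square mult_ac)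
  qed
qed

text \<open>Twice the \<open>\<partial>\<close>-part of \<open>dr\<close>: the complex linear form whose real part is \<open>dr\<close>.\<close>

definition complex_differential :: "(complex^'n::finite \<Rightarrow> real) \<Rightarrow> complex^'n \<Rightarrow> complex^'n \<Rightarrow> complex"
  where "complex_differential r a v =
    Complex (frechet_derivative r (at a) v) (- frechet_derivative r (at a) (\<i> *s v))"

lemma complex_tangent_space_iff:
  "v \<in> complex_tangent_space r a \<longleftrightarrow> complex_differential r a v = 0"
  by (simp add: complex_tangent_space_def complex_differential_def complex_eq_iff)

text \<open>The form is complex linear because its imaginary part is minus dr(iv). As dr is only
  real linear, scaling by \<open>c\<close> is split into the real and imaginary parts of
  \<open>c\<close>.\<close>

lemma
  assumes "r differentiable (at a)"
  shows complex_differential_add: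
      "complex_differential r a (v + w) = complex_differential r a v + complex_differential r a w"
    and complex_differential_scale:
      "complex_differential r a (c *s v) = c * complex_differential r a v"
proof -
  have lin: "linear (frechet_derivative r (at a))"
    using assms linear_frechet_derivative by blast
  show "complex_differential r a (v + w) = complex_differential r a v + complex_differential r a w"
    by (simp add: complex_differential_def complex_eq_iff vector_add_ldistrib linear_add[OF lin])
  have c: "c *s v = Re c *\<^sub>R v + Im c *\<^sub>R (\<i> *s v)"
    by (simp add: vec_eq_iff complex_eq_iff)
  have ic: "\<i> *s (c *s v) = Re c *\<^sub>R (\<i> *s v) - Im c *\<^sub>R v"
    by (simp add: vec_eq_iff complex_eq_iff)
  show "complex_differential r a (c *s v) = c * complex_differential r a v"
    unfolding complex_differential_def ic
    unfolding c linear_add[OF lin] linear_diff[OF lin] linear_scale[OF lin]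
    by (simp add: complex_eq_iff)
qed

lemma complex_differential_sum:
  assumes "r differentiable (at a)"
  shows "complex_differential r a (\<Sum>i\<in>I. v i) = (\<Sum>i\<in>I. complex_differential r a (v i))"
proof -
  have "complex_differential r a 0 = 0"
    using complex_differential_scale[OF assms, of 0 0] by simp
  then show ?thesis
    by (induction I rule: infinite_finite_induct) (auto simp: complex_differential_add[OF assms])
qed

text \<open>Expanding \<open>v\<close> in the real basis separates the variables: the coefficients
  depend linearly on \<open>v\<close>, the partial derivatives continuously on the point. Continuity
  in the pair is what makes the sets used in Fubini's theorem open.\<close>

lemma continuous_on_complex_differential:
  assumes "smooth_on UNIV r"
  shows "continuous_on UNIV (\<lambda>(a, v). complex_differential r a v)"
proof -
  have lin: "linear (frechet_derivative r (at a))" for a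
    using smooth_on_imp_C2(1)[OF assms] linear_frechet_derivative by blast
  have cont: "continuous_on UNIV (\<lambda>a. frechet_derivative r (at a) b)" for b
    using smooth_on_imp_C2(2)[OF assms]
    by (simp add: continuous_at_imp_continuous_on differentiable_imp_continuous_within)
  have rep: "frechet_derivative r (at a) v = (\<Sum>b\<in>Basis. (v \<bullet> b) * frechet_derivative r (at a) b)" for a v
  proof -
    have "frechet_derivative r (at a) v = frechet_derivative r (at a) (\<Sum>b\<in>Basis. (v \<bullet> b) *\<^sub>R b)"
      by (simp add: euclidean_representation)
    also have "\<dots> = (\<Sum>b\<in>Basis. (v \<bullet> b) * frechet_derivative r (at a) b)"
      by (simp only: linear_sum[OF lin] linear_scale[OF lin] real_scaleR_def)
    finally show ?thesis .
  qed
  have "continuous_on UNIV (\<lambda>p. \<i> *s snd p :: complex^'a)"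
    unfolding vector_scalar_mult_def by (intro continuous_intros)
  then show ?thesis
    unfolding complex_differential_def Complex_eq case_prod_beta rep[of _ "snd _"] rep[of _ "\<i> *s snd _"]
    by (intro continuous_intros continuous_on_compose2[OF cont]) auto
qed

section \<open>Hermitian orthonormal bases\<close>

lemma cmod_hermitian_inner_le: "cmod (hermitian_inner u v) \<le> norm u * norm v"
proof -
  have "cmod (hermitian_inner u v) \<le> (\<Sum>i\<in>UNIV. \<bar>cmod (u $ i)\<bar> * \<bar>cmod (v $ i)\<bar>)"
    unfolding hermitian_inner_def by (rule order_trans[OF norm_sum]) (simp add: norm_mult)
  also have "\<dots> \<le> norm u * norm v"
    unfolding norm_vec_def by (rule L2_set_mult_ineq)
  finally show ?thesis .
qed

lemma hermitian_inner_self: "hermitian_inner v v = of_real ((norm v)\<^sup>2)"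
proof -
  have "(norm v)\<^sup>2 = (\<Sum>i\<in>UNIV. (cmod (v $ i))\<^sup>2)"
    by (simp add: norm_vec_def L2_set_def sum_nonneg)
  then show ?thesis by (simp add: hermitian_inner_def complex_mult_cnj cmod_power2)
qed

lemma norm_eq_1_hermitian: "norm v = 1" if "hermitian_inner v v = 1"
proof -
  have "(norm v)\<^sup>2 = 1" using that unfolding hermitian_inner_self of_real_eq_1_iff .
  then show ?thesis using norm_ge_zero[of v] unfolding power2_eq_1_iff by linarith
qed

text \<open>With the vectors as rows of \<open>M\<close> and with \<open>N\<close> its conjugate
  transpose, orthonormality says M N = 1; for square matrices N M = 1 follows, which is completeness
  of the system.\<close>

lemma orthonormal_expansion:
  fixes b :: "'n \<Rightarrow> complex^'n::finite"
  assumes "\<And>i j. hermitian_inner (b i) (b j) = (if i = j then 1 else 0)"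
  shows "(\<Sum>j\<in>UNIV. hermitian_inner v (b j) *s b j) = v"
proof -
  define M :: "complex^'n^'n" where "M = (\<chi> i j. b i $ j)"
  define N :: "complex^'n^'n" where "N = (\<chi> i j. cnj (b j $ i))"
  have "M ** N = mat 1"
    using assms by (simp add: M_def N_def matrix_matrix_mult_def mat_def vec_eq_iff hermitian_inner_def)
  then have "N ** M = mat 1" using matrix_left_right_inverse by blast
  then have NM: "(\<Sum>j\<in>UNIV. cnj (b j $ k) * b j $ i) = (if k = i then 1 else 0)" for k i
    by (simp add: M_def N_def matrix_matrix_mult_def mat_def vec_eq_iff)
  have "(\<Sum>j\<in>UNIV. hermitian_inner v (b j) *s b j) $ i = v $ i" for i
  proof -
    have "(\<Sum>j\<in>UNIV. hermitian_inner v (b j) *s b j) $ i = (\<Sum>j\<in>UNIV. \<Sum>k\<in>UNIV. v $ k * (cnj (b j $ k) * b j $ i))"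
      by (simp add: hermitian_inner_def sum_distrib_right mult.assoc)
    also have "\<dots> = (\<Sum>k\<in>UNIV. v $ k * (\<Sum>j\<in>UNIV. cnj (b j $ k) * b j $ i))"
      by (subst sum.swap) (simp add: sum_distrib_left)
    also have "\<dots> = v $ i" by (simp add: NM if_distrib[of "(*) _"] cong: if_cong)
    finally show ?thesis .
  qed
  then show ?thesis by (simp add: vec_eq_iff)
qed

lemma hermitian_inner_orthonormal_sum:
  fixes b :: "'n \<Rightarrow> complex^'n::finite"
  assumes "\<And>i j. hermitian_inner (b i) (b j) = (if i = j then 1 else 0)"
  shows "hermitian_inner (\<Sum>j\<in>UNIV. c j *s b j) (b i) = c i"
proof -
  have "hermitian_inner (\<Sum>j\<in>UNIV. c j *s b j) (b i) = (\<Sum>k\<in>UNIV. \<Sum>j\<in>UNIV. c j * (b j $ k * cnj (b i $ k)))"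
    by (simp add: hermitian_inner_def sum_distrib_right mult.assoc)
  also have "\<dots> = (\<Sum>j\<in>UNIV. c j * hermitian_inner (b j) (b i))"
    by (subst sum.swap) (simp add: hermitian_inner_def sum_distrib_left)
  finally show ?thesis by (simp add: assms if_distrib[of "(*) _"] cong: if_cong)
qed

text \<open>Replaces the existential coefficients in the polydiscs by conditions on \<open>z\<close>
  itself, which are visibly open and can be estimated by Cauchy-Schwarz.\<close>

lemma orthonormal_box_eq:
  fixes b :: "'n \<Rightarrow> complex^'n::finite"
  assumes "\<And>i j. hermitian_inner (b i) (b j) = (if i = j then 1 else 0)"
  shows "{a + (\<Sum>j\<in>UNIV. c j *s b j) | c. \<forall>j. cmod (c j) < \<rho> j}
       = {z. \<forall>j. cmod (hermitian_inner (z - a) (b j)) < \<rho> j}"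
proof (intro set_eqI iffI)
  fix z assume "z \<in> {z. \<forall>j. cmod (hermitian_inner (z - a) (b j)) < \<rho> j}"
  then show "z \<in> {a + (\<Sum>j\<in>UNIV. c j *s b j) | c. \<forall>j. cmod (c j) < \<rho> j}"
    using orthonormal_expansion[OF assms, of "z - a"]
    by (intro CollectI exI[of _ "\<lambda>j. hermitian_inner (z - a) (b j)"]) auto
qed (auto simp: hermitian_inner_orthonormal_sum[OF assms])

text \<open>The form vanishes on the tangential vectors of the basis, so only the
  \<open>\<iota>\<close> component of \<open>v\<close> survives. This links the normal coordinate in
  a polydisc to the differential.\<close>

lemma complex_differential_adapted_basis:
  assumes b: "adapted_basis r \<alpha> \<iota> b" and r: "r differentiable (at \<alpha>)"
  shows "complex_differential r \<alpha> v = hermitian_inner v (b \<iota>) * complex_differential r \<alpha> (b \<iota>)"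
proof -
  have o: "\<And>i j. hermitian_inner (b i) (b j) = (if i = j then 1 else 0)"
    and sp: "vec.span (b ` (- {\<iota>})) = complex_tangent_space r \<alpha>"
    using b by (auto simp: adapted_basis_def)
  have "complex_differential r \<alpha> (b j) = 0" if "j \<noteq> \<iota>" for j
    unfolding complex_tangent_space_iff[symmetric] sp[symmetric]
    using that by (intro vec.span_base) auto
  then have "(\<Sum>j\<in>UNIV. complex_differential r \<alpha> (hermitian_inner v (b j) *s b j))
     = (\<Sum>j\<in>UNIV. if j = \<iota> then hermitian_inner v (b \<iota>) * complex_differential r \<alpha> (b \<iota>) else 0)"
    by (intro sum.cong) (auto simp: complex_differential_scale[OF r])
  then show ?thesis
    using complex_differential_sum[OF r, of "\<lambda>j. hermitian_inner v (b j) *s b j" UNIV]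
    by (simp add: orthonormal_expansion[OF o])
qed

subsection \<open>Anisotropic balls\<close>

text \<open>With \<kappa> = 1 the unweighted case \<open>j = 0\<close> becomes an instance of the
  density formula, so both branches are treated alike.\<close>

lemma weighted_measure_eq_density:
  obtains \<kappa> where "\<kappa> > 0"
    "weighted_measure \<Omega> r j = density (restrict_space lborel \<Omega>) (\<lambda>z. ennreal (\<kappa> * (- r z) ^ j))"
proof (cases "j = 0")
  case True
  then show ?thesis using that[of 1] by (simp add: weighted_measure_def density_1)
next
  case False
  then show ?thesis
    using that[of "real (j + 1) * unit_ball_vol (real (2 * (j + 1)))"]
    by (simp add: weighted_measure_def)
qed

text \<open>By Lindelof's theorem countably many of the sets \<open>\<Omega> \<inter> P a\<close>
  already cover \<Omega>. Sigma-finiteness is what permits the exchange of integrals.\<close>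

lemma borel_measure_on_sigma_finite:
  fixes \<Omega> :: "'a::second_countable_topology set"
  assumes \<mu>: "borel_measure_on \<Omega> \<mu>" and \<Omega>: "open \<Omega>"
    and op: "\<And>a. a \<in> \<Omega> \<Longrightarrow> open (P a)" and mem: "\<And>a. a \<in> \<Omega> \<Longrightarrow> a \<in> P a"
    and fin: "\<And>a. a \<in> \<Omega> \<Longrightarrow> emeasure \<mu> (\<Omega> \<inter> P a) < \<infinity>"
  shows "sigma_finite_measure \<mu>"
proof -
  have sets: "sets \<mu> = sets (restrict_space borel \<Omega>)" using \<mu> by (simp add: borel_measure_on_def)
  then have space: "space \<mu> = \<Omega>" by (simp add: sets_eq_imp_space_eq[OF sets] space_restrict_space)
  obtain F where F: "F \<subseteq> (\<lambda>a. \<Omega> \<inter> P a) ` \<Omega>" "countable F" "\<Union>F = \<Union>((\<lambda>a. \<Omega> \<inter> P a) ` \<Omega>)"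
    using op \<Omega> by (rule_tac Lindelof[of "(\<lambda>a. \<Omega> \<inter> P a) ` \<Omega>"]) auto
  have "\<Omega> \<inter> P a \<in> sets \<mu>" if "a \<in> \<Omega>" for a
    unfolding sets sets_restrict_space using op[OF that] by auto
  moreover have "\<Union>F = \<Omega>" unfolding F(3) using mem by auto
  moreover have "\<exists>a\<in>\<Omega>. A = \<Omega> \<inter> P a" if "A \<in> F" for A using F(1) that by auto
  ultimately show ?thesis
    using F(2) fin by (intro sigma_finite_measure.intro exI[of _ F]) (force simp: space less_top)
qed

text \<open>One constant \<open>K\<close> gathers the quantitative facts about the domain. Lower
  bounds have the form 1 \<le> K * x, so that each clause survives enlarging \<open>K\<close>. In
  \<open>taylor\<close> the segment from \<open>a\<close> to \<open>a + v\<close> may leave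
  \<Omega>, which need not be convex.\<close>

locale controlled_polydiscs =
  fixes \<Omega> U :: "(complex^'n::finite) set"
    and r :: "complex^'n \<Rightarrow> real"
    and \<iota> :: "'n"
    and L :: "complex^'n \<Rightarrow> 'n \<Rightarrow> complex^'n"
    and K :: real
  assumes r_smooth: "smooth_on UNIV r"
    and \<Omega>_eq: "\<Omega> = {z. r z < 0}"
    and K_ge_1: "K \<ge> 1"
    and card_le_K: "real CARD('n) \<le> K"
    and r_le_K: "a \<in> \<Omega> \<Longrightarrow> \<bar>r a\<bar> \<le> K"
    and diam_le_K: "a \<in> \<Omega> \<Longrightarrow> z \<in> \<Omega> \<Longrightarrow> norm (z - a) \<le> K"
    and differential_le: "a \<in> closure \<Omega> \<Longrightarrow> cmod (complex_differential r a v) \<le> K * norm v"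
    and differential_lipschitz: "a \<in> closure \<Omega> \<Longrightarrow> z \<in> closure \<Omega> \<Longrightarrow>
      cmod (complex_differential r z v - complex_differential r a v) \<le> K * norm (z - a) * norm v"
    and taylor: "a \<in> \<Omega> \<Longrightarrow> norm v \<le> 1 \<or> a + v \<in> \<Omega> \<Longrightarrow>
      \<bar>r (a + v) - r a - Re (complex_differential r a v)\<bar> \<le> K * (norm v)\<^sup>2"
    and projection: "a \<in> U \<Longrightarrow> closest_point (frontier \<Omega>) a \<in> frontier \<Omega>"
    and dist_projection_le: "a \<in> U \<Longrightarrow> norm (a - closest_point (frontier \<Omega>) a) \<le> K * \<bar>r a\<bar>"
    and adapted: "\<alpha> \<in> frontier \<Omega> \<Longrightarrow> adapted_basis r \<alpha> \<iota> (L \<alpha>)"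
    and normal_derivative_ge: "\<alpha> \<in> frontier \<Omega> \<Longrightarrow> 1 \<le> K * cmod (complex_differential r \<alpha> (L \<alpha> \<iota>))"
    and inner_infdist_ge: "a \<in> \<Omega> - U \<Longrightarrow> 1 \<le> K * infdist a (- \<Omega>)"
    and inner_r_ge: "a \<in> \<Omega> - U \<Longrightarrow> 1 \<le> K * \<bar>r a\<bar>"
begin

lemma r_differentiable: "r differentiable (at a)"
  using smooth_on_imp_C2(1)[OF r_smooth] .

lemma r_continuous: "continuous_on A r"
  by (intro continuous_at_imp_continuous_on ballI differentiable_imp_continuous_within r_differentiable)

lemma \<Omega>_open: "open \<Omega>"
  unfolding \<Omega>_eq by (intro open_Collect_less r_continuous continuous_on_const)

lemma r_pos: "a \<in> \<Omega> \<Longrightarrow> \<bar>r a\<bar> > 0" "a \<in> \<Omega> \<Longrightarrow> \<bar>r a\<bar> = - r a"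
  by (auto simp: \<Omega>_eq)

text \<open>
  A replacement for the polydiscs \<open>P\<^sub>a(t) - a\<close> that does not refer to the bases \<open>L\<close>,
  depends measurably on \<open>a\<close>, is invariant under rotations and scales linearly in \<open>t\<close>.
\<close>

definition aniso :: "complex^'n \<Rightarrow> real \<Rightarrow> (complex^'n) set" where
  "aniso a t = {v. cmod (complex_differential r a v) < t * \<bar>r a\<bar> \<and> norm v < t * sqrt \<bar>r a\<bar>}"

text \<open>The four factors of \<open>K\<close> are absorbed in \<open>aniso_mem_polydisc\<close>:
  the Lipschitz constant of the differential, the distance to the projection, the bound on sqrt |r
  a|, and the normal derivative.\<close>

definition \<epsilon> :: real where "\<epsilon> = 1 / (4 * K ^ 4)"

lemma \<epsilon>_pos: "\<epsilon> > 0" using K_ge_1 by (simp add: \<epsilon>_def)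

lemma \<epsilon>_le: "K ^ 4 * \<epsilon> \<le> 1/4" "K ^ 3 * \<epsilon> \<le> 1/4" "K ^ 2 * \<epsilon> \<le> 1/4" "K * \<epsilon> \<le> 1/4" "\<epsilon> \<le> 1/4"
proof -
  show 4: "K ^ 4 * \<epsilon> \<le> 1/4" using K_ge_1 by (simp add: \<epsilon>_def)
  have "K ^ i * \<epsilon> \<le> K ^ 4 * \<epsilon>" if "i \<le> 4" for i
    using K_ge_1 \<epsilon>_pos that by (intro mult_right_mono power_increasing) auto
  from this[of 3] this[of 2] this[of 1] this[of 0] 4
  show "K ^ 3 * \<epsilon> \<le> 1/4" "K ^ 2 * \<epsilon> \<le> 1/4" "K * \<epsilon> \<le> 1/4" "\<epsilon> \<le> 1/4" by auto
qed

lemma aniso_norm_sq: "v \<in> aniso a t \<Longrightarrow> t > 0 \<Longrightarrow> (norm v)\<^sup>2 \<le> t\<^sup>2 * \<bar>r a\<bar>"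
proof -
  assume "v \<in> aniso a t" "t > 0"
  then have "(norm v)\<^sup>2 \<le> (t * sqrt \<bar>r a\<bar>)\<^sup>2" by (intro power_mono) (auto simp: aniso_def)
  then show ?thesis by (simp add: power_mult_distrib)
qed

lemma aniso_circular:
  assumes "v \<in> aniso a t" "cmod c \<le> 1"
  shows "c *s v \<in> aniso a t"
proof -
  have "cmod c * cmod (complex_differential r a v) \<le> cmod (complex_differential r a v)"
    "cmod c * norm v \<le> norm v"
    using assms by (auto intro: mult_left_le_one_le)
  then show ?thesis
    using assms by (auto simp: aniso_def complex_differential_scale[OF r_differentiable] norm_mult norm_vector_scalar_mult)
qed

lemma complex_differential_scaleR:
  "complex_differential r a (t *\<^sub>R v) = of_real t * complex_differential r a v"
proof -
  have "(t *\<^sub>R v) $ i = (complex_of_real t *s v) $ i" for i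
    using scaleR_conv_of_real[of t "v $ i"] by simp
  then have "t *\<^sub>R v = complex_of_real t *s v" unfolding vec_eq_iff by blast
  then show ?thesis by (simp only: complex_differential_scale[OF r_differentiable])
qed

lemma aniso_scale: "t > 0 \<Longrightarrow> (\<lambda>v. t *\<^sub>R v) -` aniso a t = aniso a 1"
  by (auto simp: aniso_def complex_differential_scaleR norm_mult)

text \<open>Strict inequalities between functions continuous in the pair. This subset of the product
  is the region over which the integrations in \<open>a\<close> and in \<open>z\<close> are
  exchanged.\<close>

lemma aniso_diff_open: "open {(a, z). z - a \<in> aniso a t}"
proof -
  have "continuous_on UNIV (\<lambda>x::(complex^'n) \<times> (complex^'n). complex_differential r (fst x) (snd x - fst x))"
    using continuous_on_compose2[OF continuous_on_complex_differential[OF r_smooth],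
        of UNIV "\<lambda>x. (fst x, snd x - fst x)"]
    by (simp add: continuous_intros)
  moreover have "continuous_on UNIV (\<lambda>x::(complex^'n) \<times> (complex^'n). r (fst x))"
    by (rule continuous_on_compose2[OF r_continuous]) (auto intro!: continuous_intros)
  ultimately show ?thesis
    unfolding aniso_def mem_Collect_eq case_prod_beta
    by (intro open_Collect_conj open_Collect_less continuous_intros)
qed

lemma aniso_pair_open: "open {(a, v). v \<in> aniso a t}"
proof -
  have "{(a, v). v \<in> aniso a t} = (\<lambda>x. (fst x, fst x + snd x)) -` {(a, z). z - a \<in> aniso a t}"
    by auto
  also have "open \<dots>" by (intro open_vimage aniso_diff_open continuous_intros)
  finally show ?thesis .
qed

lemma aniso_open: "open (aniso a t)"
proof -
  have "aniso a t = (\<lambda>v. (a, v)) -` {(a, v). v \<in> aniso a t}" by auto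
  also have "open \<dots>" by (intro open_vimage aniso_pair_open continuous_intros)
  finally show ?thesis .
qed

section \<open>Volumes of anisotropic balls\<close>

lemma emeasure_aniso:
  assumes "t > 0"
  shows "emeasure lborel (aniso a t) = ennreal (t ^ DIM(complex^'n)) * emeasure lborel (aniso a 1)"
proof -
  have "emeasure lborel (aniso a t) = emeasure (density (distr lborel borel (\<lambda>v. 0 + t *\<^sub>R v))
     (\<lambda>_. ennreal (\<bar>t\<bar>^DIM(complex^'n)))) (aniso a t)"
    using assms by (subst lborel_affine[of t 0]) auto
  also have "\<dots> = ennreal (t ^ DIM(complex^'n)) * emeasure (distr lborel borel (\<lambda>v. t *\<^sub>R v)) (aniso a t)"
    using assms aniso_open by (subst emeasure_density) (auto simp: nn_integral_cmult_indicator)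
  also have "emeasure (distr lborel borel (\<lambda>v. t *\<^sub>R v)) (aniso a t) = emeasure lborel (aniso a 1)"
    using aniso_open assms by (subst emeasure_distr) (auto simp: aniso_scale)
  finally show ?thesis .
qed

lemma emeasure_aniso_finite: "emeasure lborel (aniso a t) < \<infinity>"
proof -
  have "aniso a t \<subseteq> ball 0 (t * sqrt \<bar>r a\<bar>)" by (auto simp: aniso_def)
  then have "emeasure lborel (aniso a t) \<le> emeasure lborel (ball (0::complex^'n) (t * sqrt \<bar>r a\<bar>))"
    by (intro emeasure_mono) auto
  then show ?thesis using emeasure_lborel_ball_finite le_less_trans by blast
qed

lemma emeasure_aniso_pos:
  assumes "a \<in> \<Omega>" "t > 0"
  shows "emeasure lborel (aniso a t) > 0"
proof -
  have "complex_differential r a 0 = 0"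
    using complex_differential_scale[OF r_differentiable, of a 0 0] by simp
  then have "0 \<in> aniso a t" using assms r_pos(1)[OF assms(1)] by (simp add: aniso_def del: zero_less_abs_iff)
  then obtain e where "e > 0" "ball 0 e \<subseteq> aniso a t"
    using aniso_open open_contains_ball by blast
  then have "emeasure lborel (ball (0::complex^'n) e) \<le> emeasure lborel (aniso a t)"
    using aniso_open by (intro emeasure_mono) auto
  moreover have "emeasure lborel (ball (0::complex^'n) e) > 0"
    using \<open>e > 0\<close> by (simp add: emeasure_ball unit_ball_vol_pos)
  ultimately show ?thesis by order
qed

lemma aniso_measurable: "(\<lambda>a. emeasure lborel (aniso a t)) \<in> borel_measurable borel"
proof -
  have "{(a, v). v \<in> aniso a t} \<in> sets (borel \<Otimes>\<^sub>M lborel)"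
    unfolding sets_pair_measure_cong[OF refl sets_lborel] borel_prod
    using aniso_pair_open[of t] by (rule borel_open)
  from lborel.measurable_emeasure_Pair[OF this] show ?thesis by (simp add: vimage_def)
qed

text \<open>Relative to |r a| both terms of Taylor's formula are small: the differential contributes
  at most 1/4, and the remainder at most 1/16 because the square of \<open>norm v\<close> is at most
  \<epsilon> squared times |r a|.\<close>

lemma aniso_\<epsilon>_subset:
  assumes a: "a \<in> \<Omega>" and v: "v \<in> aniso a \<epsilon>"
  shows "a + v \<in> \<Omega>" "\<bar>r a\<bar> \<le> 2 * \<bar>r (a + v)\<bar>" "\<bar>r (a + v)\<bar> \<le> 2 * \<bar>r a\<bar>"
proof -
  note \<rho> = r_pos[OF a]
  have sq: "(norm v)\<^sup>2 \<le> \<epsilon>\<^sup>2 * \<bar>r a\<bar>" by (rule aniso_norm_sq[OF v \<epsilon>_pos])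
  also have "\<dots> \<le> \<epsilon>\<^sup>2 * K" using r_le_K[OF a] by (intro mult_left_mono) auto
  also have "\<dots> = \<epsilon> * (K * \<epsilon>)" by (simp add: power2_eq_square)
  also have "\<dots> \<le> 1/4 * (1/4)" using \<epsilon>_le \<epsilon>_pos K_ge_1 by (intro mult_mono) auto
  \<comment> \<open>The bound on \<open>norm v\<close> gives access to \<open>taylor\<close>, since
    a + v \<in> \<Omega> is still to be shown.\<close>
  finally have "(norm v)\<^sup>2 \<le> 1\<^sup>2" by simp
  then have "norm v \<le> 1" by (rule power2_le_imp_le) auto
  then have T: "\<bar>r (a + v) - r a - Re (complex_differential r a v)\<bar> \<le> K * (norm v)\<^sup>2"
    by (intro taylor a) auto
  have "\<bar>Re (complex_differential r a v)\<bar> \<le> \<epsilon> * \<bar>r a\<bar>"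
    using v abs_Re_le_cmod[of "complex_differential r a v"] by (auto simp: aniso_def)
  also have "\<dots> \<le> 1/4 * \<bar>r a\<bar>" using \<epsilon>_le by (intro mult_right_mono) auto
  finally have R: "\<bar>Re (complex_differential r a v)\<bar> \<le> 1/4 * \<bar>r a\<bar>" .
  have "K * (norm v)\<^sup>2 \<le> K * (\<epsilon>\<^sup>2 * \<bar>r a\<bar>)" using sq K_ge_1 by (intro mult_left_mono) auto
  also have "\<dots> = \<epsilon> * (K * \<epsilon>) * \<bar>r a\<bar>" by (simp add: power2_eq_square)
  also have "\<dots> \<le> 1/4 * (1/4) * \<bar>r a\<bar>"
    using \<epsilon>_le \<epsilon>_pos K_ge_1 by (intro mult_right_mono mult_mono) auto
  finally have S: "K * (norm v)\<^sup>2 \<le> 1/16 * \<bar>r a\<bar>" by simp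
  have "r (a + v) < 0" using T R S \<rho> by linarith
  then show "a + v \<in> \<Omega>" "\<bar>r a\<bar> \<le> 2 * \<bar>r (a + v)\<bar>" "\<bar>r (a + v)\<bar> \<le> 2 * \<bar>r a\<bar>"
    using T R S \<rho> by (auto simp: \<Omega>_eq)
qed

text \<open>Changing the center alters the differential by at most
  \<open>K * norm v * norm u\<close>, a product of two lengths of order sqrt |r a|, hence of order
  |r a|: the exponents 1 and 1/2 fit together. The radius 4 leaves room for the factor 2 lost in |r
  (a + v)|.\<close>

lemma aniso_engulf:
  assumes a: "a \<in> \<Omega>" and v: "v \<in> aniso a \<epsilon>"
  shows "aniso (a + v) 1 \<subseteq> aniso a 4"
proof
  fix u assume u: "u \<in> aniso (a + v) 1"
  note z = aniso_\<epsilon>_subset[OF a v]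
  define q where "q = sqrt \<bar>r a\<bar>"
  have q: "q \<ge> 0" "q * q = \<bar>r a\<bar>" by (auto simp: q_def)
  have "sqrt \<bar>r (a + v)\<bar> \<le> sqrt (2 * \<bar>r a\<bar>)" using z(3) by simp
  also have "\<dots> \<le> sqrt (2\<^sup>2 * \<bar>r a\<bar>)" by (intro real_sqrt_le_mono mult_right_mono) auto
  also have "\<dots> = 2 * q" by (simp add: real_sqrt_mult q_def)
  finally have u2: "norm u < 2 * q" using u by (auto simp: aniso_def)
  then have "q > 0" using norm_ge_zero[of u] by linarith
  have nv: "norm v \<le> \<epsilon> * q" using v by (auto simp: aniso_def q_def)
  have "cmod (complex_differential r (a + v) u - complex_differential r a u) \<le> K * norm (a + v - a) * norm u"
    using a z(1) closure_subset by (intro differential_lipschitz) auto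
  also have "\<dots> \<le> K * (\<epsilon> * q) * (2 * q)"
    using nv u2 K_ge_1 q \<epsilon>_pos by (intro mult_mono mult_nonneg_nonneg) auto
  also have "\<dots> = 2 * (K * \<epsilon>) * \<bar>r a\<bar>" by (simp flip: q(2))
  also have "\<dots> \<le> 2 * (1/4) * \<bar>r a\<bar>" using \<epsilon>_le by (intro mult_right_mono mult_left_mono) auto
  finally have "cmod (complex_differential r (a + v) u - complex_differential r a u) \<le> 1/2 * \<bar>r a\<bar>" by simp
  moreover have "cmod (complex_differential r (a + v) u) < \<bar>r (a + v)\<bar>" using u by (simp add: aniso_def)
  moreover have "cmod (complex_differential r a u) \<le> cmod (complex_differential r (a + v) u)
       + cmod (complex_differential r (a + v) u - complex_differential r a u)"
    by (metis norm_minus_commute norm_triangle_sub)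
  ultimately have "cmod (complex_differential r a u) < 4 * \<bar>r a\<bar>" using z(3) by linarith
  moreover have "norm u < 4 * q" using u2 \<open>q > 0\<close> by linarith
  ultimately show "u \<in> aniso a 4" by (simp add: aniso_def q_def)
qed

section \<open>Comparison of the polydiscs with the anisotropic balls\<close>

lemma polydisc_U_eq:
  assumes a: "a \<in> U"
  shows "polydisc \<Omega> r U \<iota> L a t =
    {z. \<forall>j. cmod (hermitian_inner (z - a) (L (closest_point (frontier \<Omega>) a) j))
           < (if j = \<iota> then t * \<bar>r a\<bar> else t * sqrt \<bar>r a\<bar>)}"
proof -
  have o: "\<And>i j. hermitian_inner (L (closest_point (frontier \<Omega>) a) i) (L (closest_point (frontier \<Omega>) a) j)
       = (if i = j then 1 else 0)"
    using adapted[OF projection[OF a]] by (auto simp: adapted_basis_def)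
  have "(cmod (c \<iota>) < t * \<bar>r a\<bar> \<and> (\<forall>j. j \<noteq> \<iota> \<longrightarrow> cmod (c j) < t * sqrt \<bar>r a\<bar>)) \<longleftrightarrow>
    (\<forall>j. cmod (c j) < (if j = \<iota> then t * \<bar>r a\<bar> else t * sqrt \<bar>r a\<bar>))" for c :: "'n \<Rightarrow> complex"
    by auto
  then show ?thesis
    unfolding orthonormal_box_eq[OF o, symmetric] polydisc_def using a by simp
qed

lemma polydisc_open: "open (polydisc \<Omega> r U \<iota> L a t)"
proof (cases "a \<in> U")
  case True
  have "open {z. \<forall>j\<in>UNIV. cmod (hermitian_inner (z - a) (b j)) < s j}" for b :: "'n \<Rightarrow> complex^'n" and s
    unfolding hermitian_inner_def Collect_ball_eq
    by (intro open_INT ballI open_Collect_less continuous_intros finite) 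
  then show ?thesis by (simp add: polydisc_U_eq[OF True])
next
  case False
  have "polydisc \<Omega> r U \<iota> L a t = {z. \<forall>j\<in>UNIV. cmod (z $ j - a $ j)
           < (if j = \<iota> then t * infdist a (- \<Omega>) else t * sqrt (infdist a (- \<Omega>)))}"
    using False by (auto simp: polydisc_def)
  also have "open \<dots>"
    unfolding Collect_ball_eq
    by (intro open_INT ballI open_Collect_less continuous_intros finite)
  finally show ?thesis .
qed

text \<open>Center and point exchange roles. Near the boundary the differential is carried from
  \<open>a\<close> to z = a + v and on to the projection of \<open>z\<close>, where it controls the
  normal coordinate; the other coordinates are bounded by \<open>norm v\<close>. Away from the
  boundary both radii of the polydisc are at least 2/K, while \<open>norm v\<close> is below
  1/(4K).\<close>

lemma aniso_mem_polydisc: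
  assumes a: "a \<in> \<Omega>" and v: "v \<in> aniso a \<epsilon>"
  shows "a \<in> polydisc \<Omega> r U \<iota> L (a + v) 2"
proof -
  define z where "z = a + v"
  note z = aniso_\<epsilon>_subset[OF a v, folded z_def]
  define q s where "q = sqrt \<bar>r a\<bar>" and "s = sqrt \<bar>r z\<bar>"
  have "s > 0" using r_pos(1)[OF z(1)] by (simp add: s_def)
  have "q \<ge> 0" by (simp add: q_def)
  have "q \<le> sqrt (2\<^sup>2 * \<bar>r z\<bar>)" unfolding q_def using z(2) by (intro real_sqrt_le_mono) auto
  then have qs: "q \<le> 2 * s" by (simp add: real_sqrt_mult s_def)
  have "q \<le> sqrt (K\<^sup>2)"
    unfolding q_def using r_le_K[OF a] K_ge_1 self_le_power[of K 2] by (intro real_sqrt_le_mono) linarith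
  then have qK: "q \<le> K" using K_ge_1 by simp
  have nv: "norm v < \<epsilon> * q" using v by (simp add: aniso_def q_def)
  show ?thesis
  proof (cases "z \<in> U")
    case True
    define \<alpha> where "\<alpha> = closest_point (frontier \<Omega>) z"
    have \<alpha>: "\<alpha> \<in> frontier \<Omega>" using projection[OF True] by (simp add: \<alpha>_def)
    have \<alpha>z: "norm (\<alpha> - z) \<le> K * \<bar>r z\<bar>"
      using dist_projection_le[OF True] by (simp add: \<alpha>_def norm_minus_commute)
    have cl: "\<alpha> \<in> closure \<Omega>" "z \<in> closure \<Omega>" "a \<in> closure \<Omega>"
      using \<alpha> z(1) a closure_subset by (auto simp: frontier_def)
    have o: "hermitian_inner (L \<alpha> i) (L \<alpha> j) = (if i = j then 1 else 0)" for i j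
      using adapted[OF \<alpha>] by (simp add: adapted_basis_def)
    have nL: "norm (L \<alpha> j) = 1" for j
      by (simp add: norm_eq_1_hermitian o)
    have minus: "a - z = (-1) *s v" by (simp add: z_def vec_eq_iff)
    have h: "cmod (hermitian_inner (a - z) (L \<alpha> j)) < 2 * s" for j
    proof -
      have "cmod (hermitian_inner (a - z) (L \<alpha> j)) \<le> norm (a - z) * norm (L \<alpha> j)"
        by (rule cmod_hermitian_inner_le)
      also have "\<dots> < \<epsilon> * q" using nv by (simp add: nL z_def)
      also have "\<dots> \<le> 1/4 * (2 * s)" using \<epsilon>_le qs \<open>q \<ge> 0\<close> by (intro mult_mono) auto
      also have "\<dots> \<le> 2 * s" using \<open>s > 0\<close> by simp
      finally show ?thesis .
    qed
    \<comment> \<open>The first move displaces by \<open>v\<close> itself and costs the square of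
      \<open>norm v\<close>, the second displaces by O(|r z|); both errors are thus of order |r
      z|.\<close>
    have "cmod (complex_differential r \<alpha> v) \<le> cmod (complex_differential r a v)
        + cmod (complex_differential r z v - complex_differential r a v)
        + cmod (complex_differential r \<alpha> v - complex_differential r z v)"
      using norm_triangle_ineq[of "complex_differential r a v" "complex_differential r z v - complex_differential r a v"]
        norm_triangle_ineq[of "complex_differential r z v" "complex_differential r \<alpha> v - complex_differential r z v"]
      by simp
    also have "\<dots> \<le> \<epsilon> * \<bar>r a\<bar> + K * norm v * norm v + K * norm (\<alpha> - z) * norm v"
      using v differential_lipschitz[OF cl(3,2), of v] differential_lipschitz[OF cl(2,1), of v]
      by (intro add_mono) (auto simp: aniso_def z_def)
    also have "\<dots> \<le> \<epsilon> * (2 * \<bar>r z\<bar>) + K * (\<epsilon> * q) * (\<epsilon> * q) + K * (K * \<bar>r z\<bar>) * (\<epsilon> * K)"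
      using z \<epsilon>_pos K_ge_1 nv qK \<alpha>z \<open>q \<ge> 0\<close>
      by (intro add_mono mult_mono mult_nonneg_nonneg order_trans[OF less_imp_le[OF nv]]) auto
    also have "K * (\<epsilon> * q) * (\<epsilon> * q) = K * \<epsilon> * \<epsilon> * \<bar>r a\<bar>" by (simp add: q_def mult_ac)
    also have "\<dots> \<le> 1/4 * \<epsilon> * (2 * \<bar>r z\<bar>)"
      using z \<epsilon>_le \<epsilon>_pos by (intro mult_mono) auto
    finally have "cmod (complex_differential r \<alpha> v) \<le> (5/2 * \<epsilon> + K ^ 3 * \<epsilon>) * \<bar>r z\<bar>"
      by (simp add: algebra_simps power3_eq_cube)
    then have "K * cmod (complex_differential r \<alpha> v) \<le> K * ((5/2 * \<epsilon> + K ^ 3 * \<epsilon>) * \<bar>r z\<bar>)"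
      using K_ge_1 by (intro mult_left_mono) auto
    also have "\<dots> = (5/2 * (K * \<epsilon>) + K ^ 4 * \<epsilon>) * \<bar>r z\<bar>"
      by (simp add: algebra_simps power3_eq_cube power4_eq_xxxx)
    also have "\<dots> \<le> (5/2 * (1/4) + 1/4) * \<bar>r z\<bar>"
      using \<epsilon>_le by (intro mult_right_mono add_mono mult_left_mono) auto
    also have "\<dots> < 2 * \<bar>r z\<bar>"
      using r_pos(1)[OF z(1)] by (intro mult_strict_right_mono) auto
    finally have K\<alpha>: "K * cmod (complex_differential r \<alpha> v) < 2 * \<bar>r z\<bar>" .
    \<comment> \<open>The normal coordinate is the differential at \<alpha> of a - z divided by its
      value on \<open>L \<alpha> \<iota>\<close>, which has modulus at least 1/K.\<close>
    have "cmod (hermitian_inner (a - z) (L \<alpha> \<iota>)) * 1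
        \<le> cmod (hermitian_inner (a - z) (L \<alpha> \<iota>)) * (K * cmod (complex_differential r \<alpha> (L \<alpha> \<iota>)))"
      using normal_derivative_ge[OF \<alpha>] by (intro mult_left_mono) auto
    also have "\<dots> = K * cmod (complex_differential r \<alpha> (a - z))"
      unfolding complex_differential_adapted_basis[OF adapted[OF \<alpha>] r_differentiable, of "a - z"]
      by (simp add: norm_mult)
    also have "\<dots> = K * cmod (complex_differential r \<alpha> v)"
      unfolding minus complex_differential_scale[OF r_differentiable] by (simp add: norm_mult)
    also note K\<alpha>
    finally have "cmod (hermitian_inner (a - z) (L \<alpha> \<iota>)) < 2 * \<bar>r z\<bar>" by simp
    with h show ?thesis
      unfolding z_def[symmetric] polydisc_U_eq[OF True] by (auto simp: \<alpha>_def s_def)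
  next
    case False
    define \<delta> where "\<delta> = infdist z (- \<Omega>)"
    have "1 \<le> K * \<delta>" unfolding \<delta>_def using False z(1) by (intro inner_infdist_ge) auto
    then have \<delta>: "1 / K \<le> \<delta>" using K_ge_1 by (simp add: field_simps)
    have "1 / K = sqrt ((1 / K) * (1 / K))" using K_ge_1 unfolding real_sqrt_abs2 by simp
    also have "\<dots> \<le> sqrt \<delta>"
    proof (rule real_sqrt_le_mono)
      have "1 / K * (1 / K) \<le> 1 / K * 1" using K_ge_1 by (intro mult_left_mono) auto
      then show "1 / K * (1 / K) \<le> \<delta>" using \<delta> by linarith
    qed
    finally have s\<delta>: "1 / K \<le> sqrt \<delta>" .
    have "norm v < \<epsilon> * q" by (rule nv)
    also have "\<dots> \<le> \<epsilon> * K" using \<epsilon>_pos qK by (intro mult_left_mono) auto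
    also have "\<dots> = (K ^ 2 * \<epsilon>) / K" using K_ge_1 by (simp add: power2_eq_square)
    also have "\<dots> \<le> (1/4) / K" using \<epsilon>_le K_ge_1 by (intro divide_right_mono) auto
    finally have "norm v < 1/4 * (1 / K)" by simp
    moreover have "1 / K > 0" using K_ge_1 by simp
    ultimately have "norm v < 2 * \<delta>" "norm v < 2 * sqrt \<delta>" using \<delta> s\<delta> by linarith+
    moreover have "cmod (a $ j - z $ j) \<le> norm v" for j
      using Finite_Cartesian_Product.norm_nth_le[of "a - z" j] by (simp add: z_def)
    ultimately show ?thesis
      unfolding z_def[symmetric] polydisc_def using False by (auto simp: \<delta>_def intro: le_less_trans)
  qed
qed

text \<open>Near the boundary the coordinates bound the length of w - z and its differential at the
  projection; passing from the projection to \<open>z\<close> costs at most K^3 |r z|, as the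
  displacement is O(|r z|) and \<Omega> has diameter at most \<open>K\<close>. Away from the
  boundary |r z| \<ge> 1/K, and the ball contains every difference w - z of points of
  \<Omega>.\<close>

lemma polydisc_subset_aniso:
  assumes z: "z \<in> \<Omega>" and w: "w \<in> \<Omega>" "w \<in> polydisc \<Omega> r U \<iota> L z 2"
  shows "w - z \<in> aniso z (5 * K ^ 3)"
proof -
  define s v where "s = sqrt \<bar>r z\<bar>" and "v = w - z"
  have s: "s > 0" "s * s = \<bar>r z\<bar>" using r_pos(1)[OF z] by (auto simp: s_def)
  have Kp: "K ^ i \<le> K ^ 3" if "i \<le> 3" for i using K_ge_1 that by (intro power_increasing) auto
  have K3: "K ^ 3 > 0" using K_ge_1 by simp
  have vK: "norm v \<le> K" unfolding v_def using z w by (intro diam_le_K)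
  have "cmod (complex_differential r z v) < 5 * K ^ 3 * \<bar>r z\<bar> \<and> norm v < 5 * K ^ 3 * s"
  proof (cases "z \<in> U")
    case True
    have "s \<le> sqrt (K\<^sup>2)"
      unfolding s_def using r_le_K[OF z] K_ge_1 self_le_power[of K 2] by (intro real_sqrt_le_mono) linarith
    then have sK: "s \<le> K" using K_ge_1 by simp
    define \<alpha> where "\<alpha> = closest_point (frontier \<Omega>) z"
    define c where "c j = hermitian_inner v (L \<alpha> j)" for j
    have \<alpha>: "\<alpha> \<in> frontier \<Omega>" using projection[OF True] by (simp add: \<alpha>_def)
    have \<alpha>z: "norm (z - \<alpha>) \<le> K * \<bar>r z\<bar>"
      using dist_projection_le[OF True] by (simp add: \<alpha>_def)
    have cl: "\<alpha> \<in> closure \<Omega>" "z \<in> closure \<Omega>"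
      using \<alpha> z closure_subset by (auto simp: frontier_def)
    have o: "hermitian_inner (L \<alpha> i) (L \<alpha> j) = (if i = j then 1 else 0)" for i j
      using adapted[OF \<alpha>] by (simp add: adapted_basis_def)
    have nL: "norm (L \<alpha> j) = 1" for j
      by (simp add: norm_eq_1_hermitian o)
    have "\<forall>j. cmod (c j) < (if j = \<iota> then 2 * \<bar>r z\<bar> else 2 * s)"
      using w(2) unfolding polydisc_U_eq[OF True] c_def v_def \<alpha>_def s_def mem_Collect_eq .
    then have c\<iota>: "cmod (c \<iota>) \<le> 2 * \<bar>r z\<bar>" and cj: "j \<noteq> \<iota> \<Longrightarrow> cmod (c j) \<le> 2 * s" for j
      by (metis less_imp_le)+
    \<comment> \<open>The normal radius 2 |r z| is also O(s), because |r z| = s * s and s \<le> K;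
      so all coordinates obey one bound.\<close>
    have "\<bar>r z\<bar> \<le> K * s" unfolding s(2)[symmetric] using sK s by (intro mult_right_mono) auto
    moreover have "1 * s \<le> K * s" using K_ge_1 s by (intro mult_right_mono) auto
    ultimately have cK: "cmod (c j) \<le> 2 * K * s" for j
      using c\<iota> cj[of j] by (cases "j = \<iota>") auto
    have "norm v = norm (\<Sum>j\<in>UNIV. c j *s L \<alpha> j)"
      unfolding c_def orthonormal_expansion[OF o] ..
    also have "\<dots> \<le> (\<Sum>j\<in>(UNIV::'n set). 2 * K * s)"
      by (intro order_trans[OF norm_sum] sum_mono) (simp add: norm_vector_scalar_mult nL cK)
    also have "\<dots> = CARD('n) * (2 * K * s)" by simp
    also have "\<dots> \<le> K * (2 * K * s)" using card_le_K K_ge_1 s by (intro mult_right_mono) auto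
    also have "\<dots> = 2 * (K ^ 2 * s)" by (simp add: power2_eq_square)
    also have "\<dots> \<le> 2 * (K ^ 3 * s)" using Kp[of 2] s by (intro mult_left_mono mult_right_mono) auto
    also have "\<dots> < 5 * K ^ 3 * s" using K3 s by simp
    finally have 1: "norm v < 5 * K ^ 3 * s" .
    have "cmod (complex_differential r z v) \<le> cmod (complex_differential r \<alpha> v)
        + cmod (complex_differential r z v - complex_differential r \<alpha> v)"
      using norm_triangle_ineq[of "complex_differential r \<alpha> v" "complex_differential r z v - complex_differential r \<alpha> v"]
      by simp
    also have "complex_differential r \<alpha> v = c \<iota> * complex_differential r \<alpha> (L \<alpha> \<iota>)"
      unfolding c_def by (rule complex_differential_adapted_basis[OF adapted[OF \<alpha>] r_differentiable])
    also have "cmod (c \<iota> * complex_differential r \<alpha> (L \<alpha> \<iota>)) + cmod (complex_differential r z v - c \<iota> * complex_differential r \<alpha> (L \<alpha> \<iota>))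
        \<le> 2 * \<bar>r z\<bar> * K + K * (K * \<bar>r z\<bar>) * K"
    proof (intro add_mono)
      have "cmod (complex_differential r \<alpha> (L \<alpha> \<iota>)) \<le> K"
        using differential_le[OF cl(1), of "L \<alpha> \<iota>"] by (simp add: nL)
      then show "cmod (c \<iota> * complex_differential r \<alpha> (L \<alpha> \<iota>)) \<le> 2 * \<bar>r z\<bar> * K"
        unfolding norm_mult using c\<iota> by (intro mult_mono) auto
      have "cmod (complex_differential r z v - complex_differential r \<alpha> v) \<le> K * norm (z - \<alpha>) * norm v"
        by (rule differential_lipschitz[OF cl])
      also have "\<dots> \<le> K * (K * \<bar>r z\<bar>) * K"
        using \<alpha>z vK K_ge_1 by (intro mult_mono) auto
      finally show "cmod (complex_differential r z v - c \<iota> * complex_differential r \<alpha> (L \<alpha> \<iota>)) \<le> K * (K * \<bar>r z\<bar>) * K"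
        unfolding c_def complex_differential_adapted_basis[OF adapted[OF \<alpha>] r_differentiable, of v, symmetric] .
    qed
    also have "\<dots> = (2 * K ^ 1 + K ^ 3) * \<bar>r z\<bar>" by (simp add: algebra_simps power3_eq_cube)
    also have "\<dots> < 5 * K ^ 3 * \<bar>r z\<bar>"
      using Kp[of 1] K3 r_pos(1)[OF z] by (intro mult_strict_right_mono) linarith+
    finally show ?thesis using 1 by blast
  next
    case False
    have 1: "1 \<le> K * \<bar>r z\<bar>" using False z by (intro inner_r_ge) auto
    have sq: "1 \<le> K * s"
    proof -
      have "1 \<le> K * \<bar>r z\<bar>" by (rule 1)
      also have "\<dots> \<le> K * K * \<bar>r z\<bar>" using K_ge_1 by (intro mult_right_mono) auto
      also have "\<dots> = (K * s)\<^sup>2" by (simp add: power2_eq_square flip: s(2))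
      finally have "1\<^sup>2 \<le> (K * s)\<^sup>2" by simp
      then show ?thesis by (rule power2_le_imp_le) (use K_ge_1 s in auto)
    qed
    have "norm v \<le> K * (K * s)" using vK sq K_ge_1 by (metis mult.right_neutral mult_left_mono order_trans zero_le_one)
    also have "\<dots> = K ^ 2 * s" by (simp add: power2_eq_square)
    also have "\<dots> \<le> K ^ 3 * s" using Kp[of 2] s by (intro mult_right_mono) auto
    also have "\<dots> < 5 * K ^ 3 * s" using K3 s by simp
    finally have 2: "norm v < 5 * K ^ 3 * s" .
    have "cmod (complex_differential r z v) \<le> K * norm v"
      using z closure_subset by (intro differential_le) auto
    also have "\<dots> \<le> K * K * 1" using vK K_ge_1 by simp
    also have "\<dots> \<le> K * K * (K * \<bar>r z\<bar>)" using 1 K_ge_1 by (intro mult_left_mono) auto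
    also have "\<dots> = K ^ 3 * \<bar>r z\<bar>" by (simp add: power3_eq_cube)
    also have "\<dots> < 5 * K ^ 3 * \<bar>r z\<bar>" using K3 r_pos(1)[OF z] by simp
    finally show ?thesis using 2 by blast
  qed
  then show ?thesis by (simp add: aniso_def v_def s_def)
qed

text \<open>For large \<open>t\<close> Taylor's formula still yields an upper bound, though |r w|
  may be arbitrarily small. It applies without a bound on the displacement since both endpoints lie
  in \<Omega>.\<close>

lemma r_le_on_aniso:
  assumes z: "z \<in> \<Omega>" and w: "w \<in> \<Omega>" and v: "w - z \<in> aniso z t" and "t > 0"
  shows "\<bar>r w\<bar> \<le> (1 + t + K * t\<^sup>2) * \<bar>r z\<bar>"
proof -
  have T: "\<bar>r w - r z - Re (complex_differential r z (w - z))\<bar> \<le> K * (norm (w - z))\<^sup>2"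
    using taylor[OF z, of "w - z"] w by simp
  have "\<bar>Re (complex_differential r z (w - z))\<bar> \<le> t * \<bar>r z\<bar>"
    using v abs_Re_le_cmod[of "complex_differential r z (w - z)"] by (auto simp: aniso_def)
  moreover have "K * (norm (w - z))\<^sup>2 \<le> K * (t\<^sup>2 * \<bar>r z\<bar>)"
    using aniso_norm_sq[OF v \<open>t > 0\<close>] K_ge_1 by (intro mult_left_mono) auto
  ultimately have "\<bar>r w\<bar> \<le> \<bar>r z\<bar> + t * \<bar>r z\<bar> + K * (t\<^sup>2 * \<bar>r z\<bar>)" using T by linarith
  then show ?thesis by (simp add: algebra_simps)
qed

subsection \<open>The embedding\<close>

text \<open>Brings the right side of the Carleson condition to the form |r z|^j times the volume of
  \<open>aniso z 1\<close>: the weight on the polydisc is at most a constant times its value at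
  \<open>z\<close>, and the polydisc within \<Omega> lies in a dilated anisotropic ball.\<close>

lemma emeasure_weighted_polydisc_le:
  assumes z: "z \<in> \<Omega>" and \<kappa>: "\<kappa> > 0"
    "weighted_measure \<Omega> r j = density (restrict_space lborel \<Omega>) (\<lambda>z. ennreal (\<kappa> * (- r z) ^ j))"
  defines "t \<equiv> 5 * K ^ 3"
  shows "emeasure (weighted_measure \<Omega> r j) (\<Omega> \<inter> polydisc \<Omega> r U \<iota> L z 2)
    \<le> ennreal (\<kappa> * ((1 + t + K * t\<^sup>2) * \<bar>r z\<bar>) ^ j * t ^ DIM(complex^'n)) * emeasure lborel (aniso z 1)"
proof -
  let ?P = "polydisc \<Omega> r U \<iota> L z 2"
  let ?M = "1 + t + K * t\<^sup>2"
  have t: "t > 0" using K_ge_1 by (simp add: t_def)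
  have [measurable]: "r \<in> borel_measurable borel"
    by (rule borel_measurable_continuous_onI[OF r_continuous])
  have [measurable]: "\<Omega> \<in> sets borel" "?P \<in> sets borel" using \<Omega>_open polydisc_open by auto
  have [measurable]: "{w. w - z \<in> aniso z t} \<in> sets borel"
  proof -
    have "{w. w - z \<in> aniso z t} = (\<lambda>w. w - z) -` aniso z t" by auto
    also have "open \<dots>" by (intro open_vimage aniso_open continuous_intros)
    finally show ?thesis by auto
  qed
  have "(\<lambda>z. ennreal (\<kappa> * (- r z) ^ j)) \<in> borel_measurable (restrict_space lborel \<Omega>)"
    by (intro measurable_restrict_space1) measurable
  moreover have "\<Omega> \<inter> ?P \<in> sets (restrict_space lborel \<Omega>)"
    by (auto simp: sets_restrict_space)
  ultimately have "emeasure (weighted_measure \<Omega> r j) (\<Omega> \<inter> ?P)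
      = (\<integral>\<^sup>+ w. ennreal (\<kappa> * (- r w) ^ j) * indicator (\<Omega> \<inter> ?P) w \<partial>restrict_space lborel \<Omega>)"
    unfolding \<kappa>(2) by (rule emeasure_density)
  also have "\<dots> = (\<integral>\<^sup>+ w. ennreal (\<kappa> * (- r w) ^ j) * indicator (\<Omega> \<inter> ?P) w * indicator \<Omega> w \<partial>lborel)"
    by (subst nn_integral_restrict_space) auto
  also have "\<dots> \<le> (\<integral>\<^sup>+ w. ennreal (\<kappa> * (?M * \<bar>r z\<bar>) ^ j) * indicator {w. w - z \<in> aniso z t} w \<partial>lborel)"
  proof (intro nn_integral_mono)
    fix w
    show "ennreal (\<kappa> * (- r w) ^ j) * indicator (\<Omega> \<inter> ?P) w * indicator \<Omega> w
        \<le> ennreal (\<kappa> * (?M * \<bar>r z\<bar>) ^ j) * indicator {w. w - z \<in> aniso z t} w"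
    proof (cases "w \<in> \<Omega> \<inter> ?P")
      case True
      then have w: "w - z \<in> aniso z t" unfolding t_def using z by (intro polydisc_subset_aniso) auto
      have "- r w \<le> ?M * \<bar>r z\<bar>" "0 \<le> - r w"
        using r_le_on_aniso[OF z _ w t] r_pos(2)[of w] True by (auto simp: \<Omega>_eq)
      then have "\<kappa> * (- r w) ^ j \<le> \<kappa> * (?M * \<bar>r z\<bar>) ^ j"
        using \<kappa>(1) by (intro mult_left_mono power_mono) auto
      then show ?thesis using w True by (simp add: ennreal_leI)
    qed simp
  qed
  also have "\<dots> = ennreal (\<kappa> * (?M * \<bar>r z\<bar>) ^ j) * emeasure lborel (aniso z t)"
    using aniso_open by (simp add: nn_integral_cmult_indicator emeasure_lborel_translate)
  also have "\<dots> = ennreal (\<kappa> * (?M * \<bar>r z\<bar>) ^ j * t ^ DIM(complex^'n)) * emeasure lborel (aniso z 1)"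
    using t \<kappa>(1) K_ge_1 by (subst emeasure_aniso) (auto simp: ennreal_mult mult.assoc)
  finally show ?thesis .
qed

text \<open>The volume of \<open>aniso a \<epsilon>\<close> is traded for that of
  \<open>aniso z 1\<close>. Apart from the indicator the integrand then depends on \<open>z\<close>
  alone, so that a later integration in \<open>a\<close> only sees the indicator.\<close>

lemma submean_value_aniso:
  assumes f: "holomorphic_several_on f \<Omega>" and p: "p \<ge> 1" and a: "a \<in> \<Omega>"
  shows "ennreal (cmod (f a) powr p) \<le>
    (\<integral>\<^sup>+ z. indicator {(a, z). z - a \<in> aniso a \<epsilon>} (a, z) * (indicator \<Omega> z * ennreal (cmod (f z) powr p) *
       (ennreal ((4 / \<epsilon>) ^ DIM(complex^'n)) / emeasure lborel (aniso z 1))) \<partial>lborel)"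
proof -
  define E where "E = emeasure lborel (aniso a \<epsilon>)"
  define G where "G z = indicator \<Omega> z * ennreal (cmod (f z) powr p)" for z
  define H where "H z = ennreal ((4 / \<epsilon>) ^ DIM(complex^'n)) / emeasure lborel (aniso z 1)" for z
  define I where "I z = (indicator {(a, z). z - a \<in> aniso a \<epsilon>} (a, z) :: ennreal)" for z
  have E: "0 < E" "E < \<infinity>"
    unfolding E_def using emeasure_aniso_pos[OF a \<epsilon>_pos] emeasure_aniso_finite by auto
  have G_meas [measurable]: "G \<in> borel_measurable borel"
    unfolding G_def using \<Omega>_open p
    by (intro borel_measurable_indicator_times_ennreal continuous_on_cmod_powr
         holomorphic_several_on_imp_continuous_on[OF f]) auto
  have H_meas [measurable]: "H \<in> borel_measurable borel"
    unfolding H_def using aniso_measurable[of 1] by measurable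
  have I_meas [measurable]: "I \<in> borel_measurable borel"
  proof -
    have "I = indicator ((\<lambda>z. (a, z)) -` {(a, z). z - a \<in> aniso a \<epsilon>})" by (auto simp: I_def indicator_def)
    moreover have "open ((\<lambda>z. (a, z)) -` {(a, z). z - a \<in> aniso a \<epsilon>})"
      by (intro open_vimage aniso_diff_open continuous_intros)
    ultimately show ?thesis by simp
  qed
  \<comment> \<open>Engulfing puts \<open>aniso z 1\<close> inside \<open>aniso a 4\<close>, whose
    volume is (4/\<epsilon>)^DIM times that of \<open>aniso a \<epsilon>\<close>; this is the origin
    of the constant.\<close>
  have HE: "1 \<le> H z * E" if z: "z \<in> \<Omega>" "z - a \<in> aniso a \<epsilon>" for z
  proof -
    define V where "V = emeasure lborel (aniso z 1)"
    have V: "0 < V" "V < \<infinity>"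
      unfolding V_def using emeasure_aniso_pos[OF z(1)] emeasure_aniso_finite by auto
    have "V \<le> emeasure lborel (aniso a 4)"
      unfolding V_def using aniso_engulf[OF a z(2)] aniso_open by (intro emeasure_mono) auto
    also have "\<dots> = ennreal (4 ^ DIM(complex^'n)) * emeasure lborel (aniso a 1)"
      by (rule emeasure_aniso) simp
    also have "ennreal (4 ^ DIM(complex^'n)) = ennreal ((4 / \<epsilon>) ^ DIM(complex^'n)) * ennreal (\<epsilon> ^ DIM(complex^'n))"
      using \<epsilon>_pos by (simp add: power_divide flip: ennreal_mult)
    also have "\<dots> * emeasure lborel (aniso a 1) = ennreal ((4 / \<epsilon>) ^ DIM(complex^'n)) * E"
      unfolding E_def emeasure_aniso[OF \<epsilon>_pos, of a] by (simp add: mult.assoc)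
    finally have "V / V \<le> ennreal ((4 / \<epsilon>) ^ DIM(complex^'n)) * E / V"
      by (rule divide_right_mono_ennreal)
    also have "\<dots> = H z * E" by (simp add: H_def V_def ennreal_times_divide mult.commute)
    finally show ?thesis using V by (simp add: ennreal_divide_self)
  qed
  have "ennreal (cmod (f a) powr p) * E \<le> (\<integral>\<^sup>+ v. indicator (aniso a \<epsilon>) v * ennreal (cmod (f (a + v)) powr p) \<partial>lborel)"
    unfolding E_def using aniso_\<epsilon>_subset(1)[OF a]
    by (intro submean_value_circular[OF f p aniso_open]) (auto intro: aniso_circular)
  also have "\<dots> = (\<integral>\<^sup>+ v. I (a + v) * G (a + v) \<partial>lborel)"
    using aniso_\<epsilon>_subset(1)[OF a] by (intro nn_integral_cong) (auto simp: I_def G_def indicator_def)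
  also have "\<dots> = (\<integral>\<^sup>+ z. I z * G z \<partial>lborel)"
    by (rule nn_integral_lborel_translate) measurable
  also have "\<dots> \<le> (\<integral>\<^sup>+ z. I z * (G z * H z) * E \<partial>lborel)"
  proof (intro nn_integral_mono)
    fix z
    show "I z * G z \<le> I z * (G z * H z) * E"
    proof (cases "z \<in> \<Omega> \<and> z - a \<in> aniso a \<epsilon>")
      case True
      then have "I z * G z * 1 \<le> I z * G z * (H z * E)" using HE by (intro mult_left_mono) auto
      then show ?thesis by (simp add: mult_ac)
    qed (auto simp: I_def G_def)
  qed
  also have "\<dots> = (\<integral>\<^sup>+ z. I z * (G z * H z) \<partial>lborel) * E"
    by (rule nn_integral_multc) measurable
  finally have "E * ennreal (cmod (f a) powr p) \<le> E * (\<integral>\<^sup>+ z. I z * (G z * H z) \<partial>lborel)"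
    by (simp add: mult.commute)
  \<comment> \<open>Cancelling \<open>E\<close> in the extended reals is legitimate because 0 < E <
    \<infinity>.\<close>
  then have "ennreal (cmod (f a) powr p) \<le> (\<integral>\<^sup>+ z. I z * (G z * H z) \<partial>lborel)"
    using E by (subst (asm) ennreal_mult_le_mult_iff) auto
  then show ?thesis by (simp add: I_def G_def H_def)
qed

proposition polydisc_embedding:
  assumes p: "p \<ge> 1"
  shows "bergman_carleson_embedding \<Omega> r (polydisc \<Omega> r U \<iota> L) p k"
  unfolding bergman_carleson_embedding_def
proof (intro allI impI)
  fix \<mu>
  assume bcm: "bergman_carleson_measure \<Omega> r (polydisc \<Omega> r U \<iota> L) k \<mu>"
  define j where "j = k - 1"
  define P where "P a = polydisc \<Omega> r U \<iota> L a 2" for a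
  define d where "d = DIM(complex^'n)"
  define t where "t = 5 * K ^ 3"
  define M where "M = 1 + t + K * t\<^sup>2"
  have t: "t > 0" using K_ge_1 by (simp add: t_def)
  have M: "M > 0" using K_ge_1 t by (simp add: M_def add_pos_nonneg)
  have \<mu>: "borel_measure_on \<Omega> \<mu>" using bcm by (simp add: bergman_carleson_measure_def)
  have sets_\<mu>: "sets \<mu> = sets (restrict_space borel \<Omega>)" using \<mu> by (simp add: borel_measure_on_def)
  have space_\<mu>: "space \<mu> = \<Omega>" by (simp add: sets_eq_imp_space_eq[OF sets_\<mu>] space_restrict_space)
  obtain C\<^sub>0 where C0: "C\<^sub>0 > 0" "\<And>a. a \<in> \<Omega> \<Longrightarrow>
      emeasure \<mu> (\<Omega> \<inter> P a) \<le> ennreal C\<^sub>0 * emeasure (weighted_measure \<Omega> r j) (\<Omega> \<inter> P a)"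
    using bcm unfolding bergman_carleson_measure_def P_def j_def by blast
  obtain \<kappa> where \<kappa>: "\<kappa> > 0"
    "weighted_measure \<Omega> r j = density (restrict_space lborel \<Omega>) (\<lambda>z. ennreal (\<kappa> * (- r z) ^ j))"
    by (rule weighted_measure_eq_density)
  \<comment> \<open>\<open>c1\<close> is the loss in the submean value inequality and
    \<open>c2\<close> the one in the Carleson condition; \<kappa> stays outside since it belongs to
    the weight of the Bergman norm.\<close>
  define c1 where "c1 = (4 / \<epsilon>) ^ d"
  define c2 where "c2 = C\<^sub>0 * (M ^ j * t ^ d)"
  have c1: "c1 > 0" using \<epsilon>_pos by (simp add: c1_def)
  have c2: "c2 > 0" using C0 M t by (simp add: c2_def)
  define V where "V z = emeasure lborel (aniso z 1)" for z
  have V: "0 < V z" "V z < \<infinity>" if "z \<in> \<Omega>" for z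
    unfolding V_def using emeasure_aniso_pos[OF that] emeasure_aniso_finite by auto
  have \<mu>P: "emeasure \<mu> (\<Omega> \<inter> P z) \<le> ennreal (c2 * (\<kappa> * (- r z) ^ j)) * V z" if z: "z \<in> \<Omega>" for z
  proof -
    have "emeasure \<mu> (\<Omega> \<inter> P z) \<le> ennreal C\<^sub>0 * emeasure (weighted_measure \<Omega> r j) (\<Omega> \<inter> P z)"
      by (rule C0(2)[OF z])
    also have "\<dots> \<le> ennreal C\<^sub>0 * (ennreal (\<kappa> * (M * \<bar>r z\<bar>) ^ j * t ^ d) * V z)"
      unfolding P_def V_def M_def t_def d_def
      by (intro mult_left_mono emeasure_weighted_polydisc_le z \<kappa>) auto
    also have "\<dots> = ennreal (C\<^sub>0 * (\<kappa> * (M * \<bar>r z\<bar>) ^ j * t ^ d)) * V z"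
      using C0(1) \<kappa>(1) M t by (simp add: ennreal_mult mult.assoc)
    also have "C\<^sub>0 * (\<kappa> * (M * \<bar>r z\<bar>) ^ j * t ^ d) = c2 * (\<kappa> * (- r z) ^ j)"
      by (simp only: r_pos(2)[OF z] c2_def power_mult_distrib mult_ac)
    finally show ?thesis .
  qed
  have P_open: "open (P a)" for a unfolding P_def by (rule polydisc_open)
  \<comment> \<open>The total mass of \<mu> is not known to be finite, but the Carleson condition
    makes \<mu> finite on the sets \<open>\<Omega> \<inter> P a\<close>, which is enough for
    Fubini's theorem.\<close>
  have \<mu>_sf: "sigma_finite_measure \<mu>"
  proof (rule borel_measure_on_sigma_finite[OF \<mu> \<Omega>_open P_open])
    fix a assume a: "a \<in> \<Omega>"
    have "complex_differential r a 0 = 0"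
      using complex_differential_scale[OF r_differentiable, of a 0 0] by simp
    then have "0 \<in> aniso a \<epsilon>" using a \<epsilon>_pos r_pos(1)[OF a] by (simp add: aniso_def del: zero_less_abs_iff)
    from aniso_mem_polydisc[OF a this] show "a \<in> P a" by (simp add: P_def)
    show "emeasure \<mu> (\<Omega> \<inter> P a) < \<infinity>"
      using \<mu>P[OF a] V(2)[OF a] by (auto simp: ennreal_mult_less_top intro: le_less_trans)
  qed
  interpret \<mu>_sf: sigma_finite_measure \<mu> by (rule \<mu>_sf)
  interpret pair_sigma_finite \<mu> lborel ..
  define Q where "Q = {(a, z). z - a \<in> aniso a \<epsilon>}"
  \<comment> \<open>\<mu> lives on the Borel subsets of \<Omega>; the identity map into
    \<open>borel\<close> transports the measurability of the open set \<open>Q\<close> to the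
    product with \<mu>.\<close>
  have "(\<lambda>a. a) \<in> measurable \<mu> borel"
    unfolding measurable_cong_sets[OF sets_\<mu> refl] by (rule measurable_restrict_space1) simp
  then have [measurable]: "(\<lambda>x. x) \<in> measurable (\<mu> \<Otimes>\<^sub>M lborel) (borel \<Otimes>\<^sub>M borel)"
    by (subst measurable_pair_iff) (auto simp: measurable_pair_iff comp_def intro: measurable_compose)
  have "Q \<in> sets (borel \<Otimes>\<^sub>M borel)"
    unfolding borel_prod Q_def by (intro borel_open aniso_diff_open)
  then have Q_meas: "(\<lambda>x. indicator Q x :: ennreal) \<in> borel_measurable (\<mu> \<Otimes>\<^sub>M lborel)"
    by measurable
  \<comment> \<open>If z - a lies in \<open>aniso a \<epsilon>\<close>, then a \<in> P z by
    \<open>aniso_mem_polydisc\<close>; this is where the Carleson condition meets the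
    kernel.\<close>
  have \<mu>Q: "(\<integral>\<^sup>+ a. indicator Q (a, z) \<partial>\<mu>) \<le> ennreal (c2 * (\<kappa> * (- r z) ^ j)) * V z" if z: "z \<in> \<Omega>" for z
  proof -
    have "(\<integral>\<^sup>+ a. indicator Q (a, z) \<partial>\<mu>) \<le> (\<integral>\<^sup>+ a. indicator (\<Omega> \<inter> P z) a \<partial>\<mu>)"
    proof (intro nn_integral_mono)
      fix a assume "a \<in> space \<mu>"
      then have "a \<in> \<Omega>" by (simp add: space_\<mu>)
      then show "(indicator Q (a, z) :: ennreal) \<le> indicator (\<Omega> \<inter> P z) a"
        using aniso_mem_polydisc[of a "z - a"] by (auto simp: Q_def P_def indicator_def)
    qed
    also have "\<dots> = emeasure \<mu> (\<Omega> \<inter> P z)"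
      using P_open[of z] by (intro nn_integral_indicator) (auto simp: sets_\<mu> sets_restrict_space)
    also note \<mu>P[OF z]
    finally show ?thesis .
  qed
  show "\<exists>C>0. \<forall>f\<in>bergman_space \<Omega> r p (k - 1). (\<integral>\<^sup>+ z. ennreal (cmod (f z) powr p) \<partial>\<mu>)
      \<le> ennreal C * bergman_norm_pow \<Omega> r p (k - 1) f"
  proof (intro exI[of _ "c1 * c2"] conjI ballI)
    show "c1 * c2 > 0" using c1 c2 by simp
    fix f assume "f \<in> bergman_space \<Omega> r p (k - 1)"
    then have f: "holomorphic_several_on f \<Omega>" by (simp add: bergman_space_def)
    define G where "G z = indicator \<Omega> z * ennreal (cmod (f z) powr p)" for z
    define H where "H z = ennreal c1 / V z" for z
    have contf: "continuous_on \<Omega> (\<lambda>z. cmod (f z) powr p)"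
      by (intro continuous_on_cmod_powr holomorphic_several_on_imp_continuous_on f p)
    have G_meas [measurable]: "G \<in> borel_measurable borel"
      unfolding G_def using \<Omega>_open contf by (intro borel_measurable_indicator_times_ennreal) auto
    have H_meas [measurable]: "H \<in> borel_measurable borel"
      unfolding H_def V_def using aniso_measurable[of 1] by measurable
    have r_meas [measurable]: "r \<in> borel_measurable borel"
      by (rule borel_measurable_continuous_onI[OF r_continuous])
    have "(\<integral>\<^sup>+ a. ennreal (cmod (f a) powr p) \<partial>\<mu>)
        \<le> (\<integral>\<^sup>+ a. (\<integral>\<^sup>+ z. indicator Q (a, z) * (G z * H z) \<partial>lborel) \<partial>\<mu>)"
      using submean_value_aniso[OF f p]
      by (intro nn_integral_mono) (simp add: space_\<mu> Q_def G_def H_def V_def c1_def d_def)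
    also have "\<dots> = (\<integral>\<^sup>+ z. (\<integral>\<^sup>+ a. indicator Q (a, z) * (G z * H z) \<partial>\<mu>) \<partial>lborel)"
    proof (rule Fubini'[symmetric])
      show "(\<lambda>(a, z). indicator Q (a, z) * (G z * H z)) \<in> borel_measurable (\<mu> \<Otimes>\<^sub>M lborel)"
        using Q_meas by (auto simp: case_prod_beta) 
    qed
    also have "\<dots> = (\<integral>\<^sup>+ z. (\<integral>\<^sup>+ a. indicator Q (a, z) \<partial>\<mu>) * (G z * H z) \<partial>lborel)"
    proof (intro nn_integral_cong nn_integral_multc)
      show "(\<lambda>a. indicator Q (a, z) :: ennreal) \<in> borel_measurable \<mu>" for z
        using measurable_Pair1[OF Q_meas, of z] by simp
    qed
    also have "\<dots> \<le> (\<integral>\<^sup>+ z. ennreal (c1 * c2) * (ennreal (\<kappa> * (- r z) ^ j) * G z) \<partial>lborel)"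
    proof (intro nn_integral_mono)
      fix z
      show "(\<integral>\<^sup>+ a. indicator Q (a, z) \<partial>\<mu>) * (G z * H z) \<le> ennreal (c1 * c2) * (ennreal (\<kappa> * (- r z) ^ j) * G z)"
      proof (cases "z \<in> \<Omega>")
        case True
        then have r: "- r z > 0" by (simp add: \<Omega>_eq)
        have "(\<integral>\<^sup>+ a. indicator Q (a, z) \<partial>\<mu>) * (G z * H z)
            \<le> (ennreal (c2 * (\<kappa> * (- r z) ^ j)) * V z) * (G z * H z)"
          using \<mu>Q[OF True] by (intro mult_right_mono) auto
        also have "\<dots> = ennreal (c2 * (\<kappa> * (- r z) ^ j)) * G z * (V z * H z)"
          by (simp add: mult_ac)
        \<comment> \<open>The volume \<open>V z\<close> cancels against the one in
          \<open>H z\<close>, leaving the Bergman weight and constants.\<close>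
        also have "V z * H z = ennreal c1"
          using V[OF True] by (simp add: H_def ennreal_times_divide mult_divide_eq_ennreal mult.commute)
        also have "ennreal (c2 * (\<kappa> * (- r z) ^ j)) * G z * ennreal c1 = ennreal (c1 * c2) * (ennreal (\<kappa> * (- r z) ^ j) * G z)"
          using c1 c2 \<kappa>(1) r by (simp add: ennreal_mult mult_ac)
        finally show ?thesis .
      qed (simp add: G_def)
    qed
    also have "\<dots> = ennreal (c1 * c2) * (\<integral>\<^sup>+ z. ennreal (\<kappa> * (- r z) ^ j) * G z \<partial>lborel)"
      by (rule nn_integral_cmult) measurable
    also have "(\<integral>\<^sup>+ z. ennreal (\<kappa> * (- r z) ^ j) * G z \<partial>lborel) = bergman_norm_pow \<Omega> r p j f"
    proof -
      have [measurable]: "\<Omega> \<in> sets borel" using \<Omega>_open by auto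
      have "(\<lambda>z. ennreal (cmod (f z) powr p)) \<in> borel_measurable (restrict_space lborel \<Omega>)"
        using borel_measurable_continuous_on_restrict[OF contf]
        by (simp add: measurable_cong_sets[OF sets_restrict_space_cong[OF sets_lborel] refl])
      moreover have "(\<lambda>z. ennreal (\<kappa> * (- r z) ^ j)) \<in> borel_measurable (restrict_space lborel \<Omega>)"
        by (intro measurable_restrict_space1) measurable
      ultimately have "bergman_norm_pow \<Omega> r p j f
         = (\<integral>\<^sup>+ z. ennreal (\<kappa> * (- r z) ^ j) * ennreal (cmod (f z) powr p) \<partial>restrict_space lborel \<Omega>)"
        unfolding bergman_norm_pow_def \<kappa>(2) by (intro nn_integral_density) auto
      also have "\<dots> = (\<integral>\<^sup>+ z. ennreal (\<kappa> * (- r z) ^ j) * ennreal (cmod (f z) powr p) * indicator \<Omega> z \<partial>lborel)"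
        by (subst nn_integral_restrict_space) auto
      finally show ?thesis by (simp add: G_def mult_ac)
    qed
    finally show "(\<integral>\<^sup>+ z. ennreal (cmod (f z) powr p) \<partial>\<mu>) \<le> ennreal (c1 * c2) * bergman_norm_pow \<Omega> r p (k - 1) f"
      by (simp add: j_def)
  qed
qed

end

section \<open>Uniform constants from compactness\<close>

lemma continuous_pos_on_compact_ge:
  fixes g :: "'a::topological_space \<Rightarrow> real"
  assumes "compact S" "continuous_on S g" "\<And>x. x \<in> S \<Longrightarrow> g x > 0"
  obtains K where "K \<ge> 0" "\<And>x. x \<in> S \<Longrightarrow> 1 \<le> K * g x"
proof (cases "S = {}")
  case True
  then show ?thesis using that[of 0] by simp
next
  case False
  then obtain x0 where x0: "x0 \<in> S" "\<And>x. x \<in> S \<Longrightarrow> g x0 \<le> g x"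
    using continuous_attains_inf[OF assms(1) _ assms(2)] by blast
  show ?thesis
  proof (rule that[of "1 / g x0"])
    show "1 / g x0 \<ge> 0" using assms(3)[OF x0(1)] by simp
    show "1 \<le> 1 / g x0 * g x" if "x \<in> S" for x
      using assms(3)[OF x0(1)] x0(2)[OF that] by (simp add: field_simps)
  qed
qed

text \<open>The segment from \<open>a\<close> to a nearest point of the complement meets the
  frontier at a point no farther from \<open>a\<close>. Boundedness makes the complement nonempty;
  for an empty set \<open>infdist\<close> would be 0 by default.\<close>

lemma frontier_dist_le_infdist_Compl:
  fixes \<Omega> :: "'a::euclidean_space set"
  assumes "open \<Omega>" "bounded \<Omega>" "a \<in> \<Omega>"
    and q: "\<And>y. y \<in> frontier \<Omega> \<Longrightarrow> dist a q \<le> dist a y"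
  shows "dist a q \<le> infdist a (- \<Omega>)"
proof -
  have "\<Omega> \<noteq> UNIV" using assms(2) not_bounded_UNIV by blast
  then have "- \<Omega> \<noteq> {}" by auto
  then obtain y where y: "y \<in> - \<Omega>" "infdist a (- \<Omega>) = dist a y"
    using infdist_attains_inf[of "- \<Omega>" a] assms(1) by (auto simp: closed_Compl)
  have "closed_segment a y \<inter> frontier \<Omega> \<noteq> {}"
    using assms(3) y(1) by (intro connected_Int_frontier) auto
  then obtain x where x: "x \<in> closed_segment a y" "x \<in> frontier \<Omega>" by auto
  have "dist a q \<le> dist a x" by (rule q[OF x(2)])
  also have "\<dots> \<le> dist a y"
    using segment_bound1[OF x(1)] by (simp add: dist_norm norm_minus_commute)
  finally show ?thesis using y(2) by simp
qed

text \<open>The constants come from compactness: of a large ball for the derivatives of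
  \<open>r\<close>, of the frontier for the nonvanishing gradient, and of the closure of \<Omega>
  minus a neighbourhood of the frontier for the distance to the complement.\<close>

lemma controlled_polydiscs_exists:
  fixes \<Omega> :: "(complex^'n::finite) set"
  assumes dom: "smooth_bounded_domain \<Omega> r" and mgf: "minimal_good_family \<Omega> r U \<iota> L"
  shows "\<exists>K. controlled_polydiscs \<Omega> U r \<iota> L K"
proof -
  have \<Omega>: "open \<Omega>" "bounded \<Omega>" "\<Omega> = {z. r z < 0}" and r: "smooth_on UNIV r"
    and grad: "\<And>z. z \<in> frontier \<Omega> \<Longrightarrow> \<not> (GDERIV r z :> 0)"
    using dom by (auto simp: smooth_bounded_domain_def)
  obtain c where c: "c > 0" "\<And>z. z \<in> closure \<Omega> \<Longrightarrow> c * infdist z (- \<Omega>) \<le> - r z"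
    using dom unfolding smooth_bounded_domain_def by blast
  have U: "U \<subseteq> \<Omega>"
    and proj: "\<And>a. a \<in> U \<Longrightarrow> \<exists>!q. q \<in> frontier \<Omega> \<and> (\<forall>y\<in>frontier \<Omega>. dist a q \<le> dist a y)"
    and adapted: "\<And>\<alpha>. \<alpha> \<in> frontier \<Omega> \<Longrightarrow> adapted_basis r \<alpha> \<iota> (L \<alpha>)"
    using mgf by (auto simp: minimal_good_family_def normal_projection_nbhd_def)
  obtain V where V: "open V" "frontier \<Omega> \<subseteq> V" "V \<inter> \<Omega> \<subseteq> U"
    using mgf unfolding minimal_good_family_def normal_projection_nbhd_def by blast
  have diff: "r differentiable (at a)" for a by (rule smooth_on_imp_C2(1)[OF r])
  have compact_fr: "compact (frontier \<Omega>)" using \<Omega>(2) by (simp add: compact_frontier_bounded)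
  have compact_cl: "compact (closure \<Omega>)" using \<Omega>(2) by simp
  obtain R where R: "R > 0" "\<And>z. z \<in> closure \<Omega> \<Longrightarrow> norm z \<le> R"
    using compact_cl compact_imp_bounded bounded_pos by metis
  \<comment> \<open>A ball is convex, as the Taylor estimates require; the extra 1 leaves room for a
    + v with \<open>norm v\<close> \<le> 1.\<close>
  define S where "S = cball (0::complex^'n) (R + 1)"
  have S: "z \<in> S" if "z \<in> closure \<Omega>" for z using R(2)[OF that] by (simp add: S_def)
  have S_add: "a + v \<in> S" if "a \<in> \<Omega>" "norm v \<le> 1" for a v
    using R(2)[of a] that norm_triangle_ineq[of a v] closure_subset by (fastforce simp: S_def)
  obtain K1 where K1: "K1 \<ge> 0"
    "\<And>x v. x \<in> S \<Longrightarrow> \<bar>frechet_derivative r (at x) v\<bar> \<le> K1 * norm v"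
    "\<And>x y v. x \<in> S \<Longrightarrow> y \<in> S \<Longrightarrow>
       \<bar>frechet_derivative r (at x) v - frechet_derivative r (at y) v\<bar> \<le> K1 * norm (x - y) * norm v"
    "\<And>x y. x \<in> S \<Longrightarrow> y \<in> S \<Longrightarrow>
       \<bar>r y - r x - frechet_derivative r (at x) (y - x)\<bar> \<le> K1 * (norm (y - x))\<^sup>2"
    using smooth_on_compact_convex_estimates[OF r, of S] by (auto simp: S_def)
  have contr: "continuous_on A r" for A
    by (intro continuous_at_imp_continuous_on ballI differentiable_imp_continuous_within diff)
  have "bounded (r ` closure \<Omega>)"
    by (intro compact_imp_bounded compact_continuous_image contr compact_cl)
  then obtain K2 where K2: "K2 > 0" "\<And>z. z \<in> closure \<Omega> \<Longrightarrow> \<bar>r z\<bar> \<le> K2"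
    unfolding bounded_pos by (metis imageI real_norm_def)
  \<comment> \<open>The sum over \<open>Basis\<close> is a continuous stand-in for the length of the
    gradient.\<close>
  obtain K3 where K3: "K3 \<ge> 0" "\<And>\<alpha>. \<alpha> \<in> frontier \<Omega> \<Longrightarrow> 1 \<le> K3 * (\<Sum>b\<in>Basis. \<bar>frechet_derivative r (at \<alpha>) b\<bar>)"
  proof (rule continuous_pos_on_compact_ge[OF compact_fr])
    show "continuous_on (frontier \<Omega>) (\<lambda>\<alpha>. \<Sum>b\<in>Basis. \<bar>frechet_derivative r (at \<alpha>) b\<bar>)"
      using smooth_on_imp_C2(2)[OF r]
      by (intro continuous_intros continuous_at_imp_continuous_on ballI differentiable_imp_continuous_within) auto
    fix \<alpha> assume \<alpha>: "\<alpha> \<in> frontier \<Omega>"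
    have D: "(r has_derivative frechet_derivative r (at \<alpha>)) (at \<alpha>)"
      using diff frechet_derivative_works by blast
    have "(\<Sum>b\<in>Basis. \<bar>frechet_derivative r (at \<alpha>) b\<bar>) \<noteq> 0"
    proof
      assume 0: "(\<Sum>b\<in>Basis. \<bar>frechet_derivative r (at \<alpha>) b\<bar>) = 0"
      have "frechet_derivative r (at \<alpha>) v = 0" for v
        using linear_abs_le_sum_Basis[OF has_derivative_linear[OF D], of v] by (simp add: 0)
      then have "frechet_derivative r (at \<alpha>) = (\<lambda>h. inner h 0)" by auto
      then show False using D grad[OF \<alpha>] by (simp add: gderiv_def)
    qed
    moreover have "(\<Sum>b\<in>Basis. \<bar>frechet_derivative r (at \<alpha>) b\<bar>) \<ge> 0" by (intro sum_nonneg) auto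
    ultimately show "(\<Sum>b\<in>Basis. \<bar>frechet_derivative r (at \<alpha>) b\<bar>) > 0" by linarith
  qed blast
  \<comment> \<open>Outside \<open>V\<close> the closure is a compact subset of \<Omega>, on which
    the distance to the complement is positive.\<close>
  obtain K4 where K4: "K4 \<ge> 0" "\<And>a. a \<in> closure \<Omega> - V \<Longrightarrow> 1 \<le> K4 * infdist a (- \<Omega>)"
  proof (rule continuous_pos_on_compact_ge[of "closure \<Omega> - V" "\<lambda>a. infdist a (- \<Omega>)"])
    show "compact (closure \<Omega> - V)" using compact_cl V(1) by (rule compact_diff)
    show "continuous_on (closure \<Omega> - V) (\<lambda>a. infdist a (- \<Omega>))"
      by (intro continuous_intros)
    fix a assume "a \<in> closure \<Omega> - V"
    then have "a \<in> \<Omega>" using V(2) \<Omega>(1) by (auto simp: frontier_def interior_open)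
    moreover have "\<Omega> \<noteq> UNIV" using \<Omega>(2) not_bounded_UNIV by blast
    ultimately show "infdist a (- \<Omega>) > 0"
      using \<Omega>(1) by (intro infdist_pos_not_in_closed) (auto simp: closed_Compl)
  qed blast
  \<comment> \<open>The 2 in \<open>2 * K1\<close> accounts for real and imaginary parts of the
    complex differential, the one in \<open>2 * R\<close> for the diameter; 1/c converts the
    distance to the complement into |r|, and the dimension comes from summing over
    \<open>Basis\<close>.\<close>
  define K where "K = 1 + CARD('n) + 2 * K1 + K2 + 2 * R + 1 / c + K3 * DIM(complex^'n) + K4 + K4 / c"
  have nn: "0 \<le> K3 * DIM(complex^'n)" "0 \<le> 1 / c" "0 \<le> K4 / c" using K3(1) K4(1) c(1) by auto
  have K: "1 \<le> K" "CARD('n) \<le> K" "2 * K1 \<le> K" "K1 \<le> K" "K2 \<le> K" "2 * R \<le> K" "1 / c \<le> K"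
    "K3 * DIM(complex^'n) \<le> K" "K4 \<le> K" "K4 / c \<le> K"
    using K1(1) K2(1) R(1) K4(1) nn unfolding K_def by linarith+
  have Re_ell: "Re (complex_differential r a v) = frechet_derivative r (at a) v" for a v
    by (simp add: complex_differential_def)
  have ni: "norm (\<i> *s v) = norm v" for v :: "complex^'n" by (simp add: norm_vector_scalar_mult)
  have cl: "a \<in> \<Omega> \<Longrightarrow> a \<in> closure \<Omega>" for a using closure_subset by auto
  have inner: "1 \<le> K4 * infdist a (- \<Omega>)" if "a \<in> \<Omega> - U" for a
    using that V(3) by (intro K4(2)) (auto intro: cl)
  have "controlled_polydiscs \<Omega> U r \<iota> L K"
  proof
    show "\<bar>r a\<bar> \<le> K" if "a \<in> \<Omega>" for a
      using K2(2)[OF cl[OF that]] K by linarith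
    show "norm (z - a) \<le> K" if "a \<in> \<Omega>" "z \<in> \<Omega>" for a z
      using R(2)[OF cl[OF that(1)]] R(2)[OF cl[OF that(2)]] norm_triangle_ineq4[of z a] K by linarith
    show "cmod (complex_differential r a v) \<le> K * norm v" if "a \<in> closure \<Omega>" for a v
    proof -
      have "cmod (complex_differential r a v) \<le> K1 * norm v + K1 * norm v"
        unfolding complex_differential_def
        using cmod_le[of "Complex (frechet_derivative r (at a) v) (- frechet_derivative r (at a) (\<i> *s v))"]
          K1(2)[OF S[OF that], of v] K1(2)[OF S[OF that], of "\<i> *s v"] by (simp add: ni)
      also have "\<dots> = 2 * K1 * norm v" by simp
      also have "\<dots> \<le> K * norm v" using K by (intro mult_right_mono) auto
      finally show ?thesis .
    qed
    show "cmod (complex_differential r z v - complex_differential r a v) \<le> K * norm (z - a) * norm v"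
      if "a \<in> closure \<Omega>" "z \<in> closure \<Omega>" for a z v
    proof -
      have "cmod (complex_differential r z v - complex_differential r a v)
          \<le> K1 * norm (z - a) * norm v + K1 * norm (z - a) * norm v"
        using cmod_le[of "complex_differential r z v - complex_differential r a v"]
          K1(3)[OF S[OF that(2)] S[OF that(1)], of v] K1(3)[OF S[OF that(2)] S[OF that(1)], of "\<i> *s v"]
        by (simp add: ni complex_differential_def abs_minus_commute mult_ac)
      also have "\<dots> = 2 * K1 * norm (z - a) * norm v" by simp
      also have "\<dots> \<le> K * norm (z - a) * norm v" using K by (intro mult_right_mono) auto
      finally show ?thesis .
    qed
    show "\<bar>r (a + v) - r a - Re (complex_differential r a v)\<bar> \<le> K * (norm v)\<^sup>2"
      if "a \<in> \<Omega>" "norm v \<le> 1 \<or> a + v \<in> \<Omega>" for a v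
    proof -
      have "a \<in> S" "a + v \<in> S" using that S S_add cl by blast+
      from K1(4)[OF this] have "\<bar>r (a + v) - r a - Re (complex_differential r a v)\<bar> \<le> K1 * (norm v)\<^sup>2"
        by (simp add: Re_ell)
      also have "\<dots> \<le> K * (norm v)\<^sup>2" using K by (intro mult_right_mono) auto
      finally show ?thesis .
    qed
    fix a assume a: "a \<in> U"
    then have ne: "frontier \<Omega> \<noteq> {}" using proj by blast
    then show "closest_point (frontier \<Omega>) a \<in> frontier \<Omega>" by (intro closest_point_in_set) auto
    have a\<Omega>: "a \<in> \<Omega>" using a U by auto
    have "dist a (closest_point (frontier \<Omega>) a) \<le> infdist a (- \<Omega>)"
      by (intro frontier_dist_le_infdist_Compl \<Omega> a\<Omega> closest_point_le) auto
    also have "\<dots> \<le> 1 / c * \<bar>r a\<bar>"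
      using c(2)[OF cl[OF a\<Omega>]] c(1) by (simp add: field_simps)
    also have "\<dots> \<le> K * \<bar>r a\<bar>" using K by (intro mult_right_mono) auto
    finally show "norm (a - closest_point (frontier \<Omega>) a) \<le> K * \<bar>r a\<bar>" by (simp add: dist_norm)
  next
    fix \<alpha> assume \<alpha>: "\<alpha> \<in> frontier \<Omega>"
    have "hermitian_inner (L \<alpha> \<iota>) (L \<alpha> \<iota>) = 1" using adapted[OF \<alpha>] by (simp add: adapted_basis_def)
    then have nL: "norm (L \<alpha> \<iota>) = 1" by (rule norm_eq_1_hermitian)
    \<comment> \<open>A basis vector has norm 1, so its component along
      \<open>L \<alpha> \<iota>\<close> is at most 1 in modulus and the normal derivative dominates
      each partial derivative.\<close>
    have b: "\<bar>frechet_derivative r (at \<alpha>) b\<bar> \<le> cmod (complex_differential r \<alpha> (L \<alpha> \<iota>))"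
      if "b \<in> Basis" for b
    proof -
      have "\<bar>frechet_derivative r (at \<alpha>) b\<bar> \<le> cmod (complex_differential r \<alpha> b)"
        using abs_Re_le_cmod[of "complex_differential r \<alpha> b"] by (simp add: Re_ell)
      also have "\<dots> = cmod (hermitian_inner b (L \<alpha> \<iota>)) * cmod (complex_differential r \<alpha> (L \<alpha> \<iota>))"
        unfolding complex_differential_adapted_basis[OF adapted[OF \<alpha>] diff, of b] by (rule norm_mult)
      also have "\<dots> \<le> 1 * cmod (complex_differential r \<alpha> (L \<alpha> \<iota>))"
        using cmod_hermitian_inner_le[of b "L \<alpha> \<iota>"] that nL by (intro mult_right_mono) auto
      finally show ?thesis by simp
    qed
    have "1 \<le> K3 * (\<Sum>b\<in>Basis. \<bar>frechet_derivative r (at \<alpha>) b\<bar>)" by (rule K3(2)[OF \<alpha>])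
    also have "\<dots> \<le> K3 * (\<Sum>b\<in>(Basis::(complex^'n) set). cmod (complex_differential r \<alpha> (L \<alpha> \<iota>)))"
      using b K3(1) by (intro mult_left_mono sum_mono) auto
    also have "\<dots> = K3 * DIM(complex^'n) * cmod (complex_differential r \<alpha> (L \<alpha> \<iota>))"
      by (simp only: sum_constant mult.assoc)
    also have "\<dots> \<le> K * cmod (complex_differential r \<alpha> (L \<alpha> \<iota>))"
      using K by (intro mult_right_mono) auto
    finally show "1 \<le> K * cmod (complex_differential r \<alpha> (L \<alpha> \<iota>))" .
  next
    fix a assume a: "a \<in> \<Omega> - U"
    have "1 \<le> K4 * infdist a (- \<Omega>)" by (rule inner[OF a])
    also have "\<dots> \<le> K * infdist a (- \<Omega>)" using K by (intro mult_right_mono infdist_nonneg) auto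
    finally show "1 \<le> K * infdist a (- \<Omega>)" .
    have "1 \<le> K4 * infdist a (- \<Omega>)" by (rule inner[OF a])
    also have "\<dots> \<le> K4 * (1 / c * \<bar>r a\<bar>)"
    proof (rule mult_left_mono[OF _ K4(1)])
      show "infdist a (- \<Omega>) \<le> 1 / c * \<bar>r a\<bar>"
        using c(2)[of a] cl[of a] a c(1) by (simp add: field_simps)
    qed
    also have "\<dots> = K4 / c * \<bar>r a\<bar>" by simp
    also have "\<dots> \<le> K * \<bar>r a\<bar>" using K by (intro mult_right_mono) auto
    finally show "1 \<le> K * \<bar>r a\<bar>" .
  qed (use r \<Omega>(3) K adapted in auto)
  then show ?thesis ..
qed

theorem corollary3p13:
  fixes \<Omega> U :: "(complex^'n::finite) set"
    and r :: "complex^'n \<Rightarrow> real"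
    and \<iota> :: "'n"
    and L :: "complex^'n \<Rightarrow> 'n \<Rightarrow> complex^'n"
    and p :: real
    and k :: nat
  assumes "strictly_pseudoconvex \<Omega> r"
    and "minimal_good_family \<Omega> r U \<iota> L"
    and "k \<ge> 1"
    and "p \<ge> 1"
  shows "bergman_carleson_embedding \<Omega> r (polydisc \<Omega> r U \<iota> L) p k"
proof -
  obtain K where "controlled_polydiscs \<Omega> U r \<iota> L K"
    using controlled_polydiscs_exists assms(1,2) unfolding strictly_pseudoconvex_def by blast
  then show ?thesis using \<open>p \<ge> 1\<close> by (rule controlled_polydiscs.polydisc_embedding)
qed

end
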